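(* Let $g \in L^2(\mathbb{R}^d)$, let $\Lambda \subseteq \mathbb{R}^d$ be a lattice and $S \in \mathrm{Sp}_{2d}(\mathbb{R})$. For a sequence $\{c_\lambda\}_{\lambda\in\Lambda}\subseteq\mathbb{C}$ put $f = \sum_{\lambda\in\Lambda} c_\lambda T_\lambda^S \mathcal{R}g$ and $f_\times = \sum_{\lambda\in\Lambda} \overline{c_\lambda} T_\lambda^S \mathcal{R}g$. Then: (1) If $\{ c_\lambda \} \in c_{00}(\Lambda)$, then $|V_gf(z)| = |V_g f_\times(z)|$ for all $z \in S(\mathbb{R}^d \times \Lambda^* )$. (2) If $\mathfrak{p}_{\Lambda^*}[\mu(S)^{-1}\mathcal{R}g] \in L^\infty(\mathcal{P}(\Lambda^* ))$ and $\{ c_\lambda \} \in \ell^2(\Lambda)$ (so that both series converge in $L^2(\mathbb{R}^d)$), then $|V_gf(z)| = |V_g f_\times(z)|$ for all $z \in S(\mathbb{R}^d \times \Lambda^* )$.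
   Context: $V_gf(x,\omega)=\int f(t)\overline{g(t-x)}e^{-2\pi i\omega\cdot t}dt$. $T_\lambda h(t)=h(t-\lambda)$, $\mathcal{R}h(t)=h(-t)$. $\mathrm{Sp}_{2d}(\mathbb{R})=\{S:S^T\mathcal{J}S=\mathcal{J}\}$, $\mathcal{J}=\begin{pmatrix}0&-I_d\\ I_d&0\end{pmatrix}$. $\mu(S)$ is the metaplectic operator associated to $S$ (unitary on $L^2(\mathbb{R}^d)$, determined up to sign), and $T_\lambda^S=\mu(S)T_\lambda\mu(S)^{-1}$. $c_{00}(\Lambda)$ is the set of sequences indexed by $\Lambda$ with finitely many nonzero entries. For $\Lambda=A\mathbb{Z}^d$: $\Lambda^*=A^{-T}\mathbb{Z}^d$, $\mathcal{P}(\Lambda^* )=A^{-T}[0,1]^d$; $\mathfrak{p}_\Gamma[\psi](t)=\sum_{\gamma\in\Gamma}|\mathcal{F}\psi(t+\gamma)|^2$ with $\mathcal{F}h(\omega)=\int h(t)e^{-2\pi i\omega\cdot t}dt$. $S(\mathbb{R}^d\times\Lambda^* )=\{S(x,\lambda):x\in\mathbb{R}^d,\lambda\in\Lambda^*\}$. *)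

theory Defs
  imports "HOL-Analysis.Analysis"
begin

type_synonym 'd rvec = "real ^ 'd"
type_synonym 'd sig = "'d rvec \<Rightarrow> complex"

section \<open>Square integrable functions on R^d (L^2 classes represented by functions)\<close>

definition L2 :: "'d::finite sig \<Rightarrow> bool" where
  "L2 f \<longleftrightarrow> f \<in> borel_measurable lborel \<and> integrable lborel (\<lambda>t. (cmod (f t))^2)"

definition l2dist :: "'d::finite sig \<Rightarrow> 'd sig \<Rightarrow> real" where
  "l2dist f h = sqrt (LINT t|lborel. (cmod (f t - h t))^2)"

definition L2_has_sum :: "('i \<Rightarrow> 'd::finite sig) \<Rightarrow> 'i set \<Rightarrow> 'd sig \<Rightarrow> bool" where
  "L2_has_sum F I f \<longleftrightarrow> L2 f \<and>
     (\<forall>e>0. \<exists>F0. finite F0 \<and> F0 \<subseteq> I \<and>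
        (\<forall>G. finite G \<and> F0 \<subseteq> G \<and> G \<subseteq> I \<longrightarrow> l2dist f (\<lambda>t. \<Sum>i\<in>G. F i t) < e))"

definition transl :: "'d::finite rvec \<Rightarrow> 'd sig \<Rightarrow> 'd sig" where
  "transl l h = (\<lambda>t. h (t - l))"

definition reflect :: "'d::finite sig \<Rightarrow> 'd sig" where
  "reflect h = (\<lambda>t. h (- t))"

definition pos :: "real ^ ('d::finite + 'd) \<Rightarrow> 'd rvec" where
  "pos z = (\<chi> k. z $ Inl k)"

definition freq :: "real ^ ('d::finite + 'd) \<Rightarrow> 'd rvec" where
  "freq z = (\<chi> k. z $ Inr k)"

definition pair_vec :: "'d::finite rvec \<Rightarrow> 'd rvec \<Rightarrow> real ^ ('d + 'd)" where
  "pair_vec x \<omega> = (\<chi> i. case i of Inl k \<Rightarrow> x $ k | Inr k \<Rightarrow> \<omega> $ k)"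

definition stft :: "'d::finite sig \<Rightarrow> 'd sig \<Rightarrow> real ^ ('d + 'd) \<Rightarrow> complex" where
  "stft g f z = (LINT t|lborel. f t * cnj (g (t - pos z))
                   * exp (- (2 * of_real pi * \<i> * of_real (freq z \<bullet> t))))"

definition tfshift :: "real ^ ('d::finite + 'd) \<Rightarrow> 'd sig \<Rightarrow> 'd sig" where
  "tfshift z h = (\<lambda>t. exp (- (of_real pi * \<i> * of_real (pos z \<bullet> freq z)))
                     * exp (2 * of_real pi * \<i> * of_real (freq z \<bullet> t)) * h (t - pos z))"

definition Jmat :: "real ^ ('d::finite + 'd) ^ ('d + 'd)" where
  "Jmat = (\<chi> i j. case (i, j) of
              (Inl a, Inr b) \<Rightarrow> (if a = b then -1 else 0)
            | (Inr a, Inl b) \<Rightarrow> (if a = b then 1 else 0)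
            | _ \<Rightarrow> 0)"

definition symplectic :: "real ^ ('d::finite + 'd) ^ ('d + 'd) \<Rightarrow> bool" where
  "symplectic S \<longleftrightarrow> transpose S ** Jmat ** S = Jmat"

definition unitary_pair :: "('d::finite sig \<Rightarrow> 'd sig) \<Rightarrow> ('d sig \<Rightarrow> 'd sig) \<Rightarrow> bool" where
  "unitary_pair U V \<longleftrightarrow>
     (\<forall>f. L2 f \<longrightarrow> L2 (U f) \<and> L2 (V f)) \<and>
     (\<forall>f h. L2 f \<longrightarrow> L2 h \<longrightarrow> (AE t in lborel. f t = h t) \<longrightarrow>
          (AE t in lborel. U f t = U h t) \<and> (AE t in lborel. V f t = V h t)) \<and>
     (\<forall>f h a. L2 f \<longrightarrow> L2 h \<longrightarrow>
          (AE t in lborel. U (\<lambda>s. f s + a * h s) t = U f t + a * U h t)) \<and>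
     (\<forall>f. L2 f \<longrightarrow> l2dist (U f) (\<lambda>_. 0) = l2dist f (\<lambda>_. 0)) \<and>
     (\<forall>f. L2 f \<longrightarrow> (AE t in lborel. V (U f) t = f t) \<and> (AE t in lborel. U (V f) t = f t))"

text \<open>U = mu(S) (up to a unimodular constant), V = mu(S)^{-1}: the unitary operators
  satisfying the symplectic covariance  mu(S) rho(z) mu(S)^{-1} = rho(S z).\<close>
definition metaplectic_pair ::
  "real ^ ('d::finite + 'd) ^ ('d + 'd) \<Rightarrow> ('d sig \<Rightarrow> 'd sig) \<Rightarrow> ('d sig \<Rightarrow> 'd sig) \<Rightarrow> bool" where
  "metaplectic_pair S U V \<longleftrightarrow> unitary_pair U V \<and>
     (\<forall>z f. L2 f \<longrightarrow> (AE t in lborel. U (tfshift z f) t = tfshift (S *v z) (U f) t))"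

definition transl_S :: "('d::finite sig \<Rightarrow> 'd sig) \<Rightarrow> ('d sig \<Rightarrow> 'd sig) \<Rightarrow> 'd rvec \<Rightarrow> 'd sig \<Rightarrow> 'd sig" where
  "transl_S U V l h = U (transl l (V h))"

definition int_vec :: "'d::finite rvec \<Rightarrow> bool" where
  "int_vec v \<longleftrightarrow> (\<forall>i. v $ i \<in> \<int>)"

definition lattice :: "real ^ 'd ^ 'd \<Rightarrow> 'd::finite rvec set" where
  "lattice A = {A *v v | v. int_vec v}"

definition dual_lattice :: "real ^ 'd ^ 'd \<Rightarrow> 'd::finite rvec set" where
  "dual_lattice A = {matrix_inv (transpose A) *v v | v. int_vec v}"

definition dual_cell :: "real ^ 'd ^ 'd \<Rightarrow> 'd::finite rvec set" where
  "dual_cell A = {matrix_inv (transpose A) *v v | v. \<forall>i. 0 \<le> v $ i \<and> v $ i \<le> 1}"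

definition fourier_trunc :: "real \<Rightarrow> 'd::finite sig \<Rightarrow> 'd sig" where
  "fourier_trunc R h = (\<lambda>\<omega>. LINT t|lborel. indicator {s. \<forall>i. \<bar>s $ i\<bar> \<le> R} t * h t
                              * exp (- (2 * of_real pi * \<i> * of_real (\<omega> \<bullet> t))))"

definition is_L2_fourier :: "'d::finite sig \<Rightarrow> 'd sig \<Rightarrow> bool" where
  "is_L2_fourier h H \<longleftrightarrow> L2 H \<and> ((\<lambda>R. l2dist H (fourier_trunc R h)) \<longlongrightarrow> 0) at_top"

text \<open>p_Gamma[psi](t) = sum_{gamma in Gamma} |F psi(t+gamma)|^2, with H = F psi.\<close>
definition periodization :: "'d::finite rvec set \<Rightarrow> 'd sig \<Rightarrow> 'd rvec \<Rightarrow> ennreal" where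
  "periodization \<Gamma> H t = (\<Sum>\<^sub>\<infinity>\<gamma>\<in>\<Gamma>. ennreal ((cmod (H (t + \<gamma>)))^2))"

end

theory Submission
  imports Defs "HOL-Probability.Characteristic_Functions"
begin

text \<open>
  By symplectic covariance \<open>T\<^sub>\<lambda>\<^sup>S\<close> is the time-frequency shift \<open>\<rho>(S(\<lambda>,0))\<close>. In the integral defining
  \<open>a\<^sub>\<lambda> = V\<^sub>g(T\<^sub>\<lambda>\<^sup>S \<R>g)(z)\<close> with \<open>z = S(x,l)\<close>, the reflection exchanging the two factors \<open>g\<close> gives
  \<open>a\<^sub>\<lambda> = exp(2\<pi>i[S(\<lambda>,0),z]) \<theta> cnj a\<^sub>\<lambda>\<close>, where \<open>\<theta>\<close> depends only on \<open>z\<close>; the symplectic form equals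
  \<open>-\<lambda>\<cdot>l\<close>, an integer for \<open>l\<close> in the dual lattice. Hence all \<open>a\<^sub>\<lambda>\<close> lie on one real line through \<open>0\<close>,
  and conjugating the coefficients does not change the modulus of \<open>\<Sum> c\<^sub>\<lambda> a\<^sub>\<lambda>\<close>.

  For square summable coefficients, Plancherel's theorem and a covering of \<open>\<real>\<^sup>d\<close> by dual cells turn the
  bound on the periodization into a Bessel inequality for the translates of \<open>\<mu>(S)\<^sup>-\<^sup>1\<R>g\<close>, which gives
  convergence; the identity passes to the limit by Cauchy-Schwarz.
\<close>

section \<open>The space of square integrable functions\<close>

text \<open>Two features of the setting shape the work. Operators act on representatives, so
  covariance, linearity and inversion hold only almost everywhere; the short-time Fourier transform
  is therefore treated as an integral pairing, which ignores null sets and is continuous by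
  Cauchy-Schwarz. Moreover, the Fourier transform of \<open>\<mu>(S)^{-1} R g\<close> is known only
  as an L2 limit of integrals over growing cubes. Plancherel is thus proved for functions both
  integrable and square integrable, which covers the truncations, and the limit is taken afterwards
  in a norm inequality.

  Plancherel itself comes from regularising with a Gaussian whose Fourier integral is explicit: the
  claim becomes that Gaussian averages of the autocorrelation of \<open>f\<close> tend to its value
  at 0. The Bessel argument consumes upper bounds only, so closed cells may overlap on their
  faces.\<close>

definition l2norm :: "'d::finite sig \<Rightarrow> real" where
  "l2norm f = sqrt (LINT t|lborel. (cmod (f t))\<^sup>2)"

lemma l2dist_eq_l2norm: "l2dist f h = l2norm (\<lambda>t. f t - h t)"
  by (simp add: l2dist_def l2norm_def)

lemma l2norm_nonneg [simp]: "0 \<le> l2norm f"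
  by (simp add: l2norm_def)

lemma l2norm_square: "(l2norm f)\<^sup>2 = (LINT t|lborel. (cmod (f t))\<^sup>2)"
  by (simp add: l2norm_def)

lemma L2_measurable [measurable_dest]: "L2 f \<Longrightarrow> f \<in> borel_measurable borel"
  by (simp add: L2_def)

lemma L2_iff_nn_integral:
  "L2 f \<longleftrightarrow> f \<in> borel_measurable borel \<and> (\<integral>\<^sup>+t. ennreal ((cmod (f t))\<^sup>2) \<partial>lborel) < \<infinity>"
  by (auto simp: L2_def integrable_iff_bounded)

lemma l2norm_square_nn:
  "L2 f \<Longrightarrow> ennreal ((l2norm f)\<^sup>2) = (\<integral>\<^sup>+t. ennreal ((cmod (f t))\<^sup>2) \<partial>lborel)"
  unfolding l2norm_square by (subst nn_integral_eq_integral) (auto simp: L2_def)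

text \<open>Fatou's lemma delivers a bound on a nonnegative integral before integrability is known;
  this turns such a bound into membership and a norm estimate.\<close>

lemma l2norm_leI:
  assumes "f \<in> borel_measurable borel" "(\<integral>\<^sup>+t. ennreal ((cmod (f t))\<^sup>2) \<partial>lborel) \<le> ennreal (B\<^sup>2)" "0 \<le> B"
  shows "L2 f" "l2norm f \<le> B"
proof -
  show *: "L2 f"
    using assms by (simp add: L2_iff_nn_integral le_less_trans)
  have "ennreal ((l2norm f)\<^sup>2) \<le> ennreal (B\<^sup>2)"
    using l2norm_square_nn[OF *] assms by simp
  then have "(l2norm f)\<^sup>2 \<le> B\<^sup>2"
    by simp
  then show "l2norm f \<le> B"
    using assms(3) by (rule power2_le_imp_le)
qed

lemma L2_zero [simp]: "L2 (\<lambda>t. 0)"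
  by (simp add: L2_def)

lemma L2_bounded_mult:
  assumes "L2 f" and [measurable]: "p \<in> borel_measurable borel" and K: "\<And>t. cmod (p t) \<le> K"
  shows "L2 (\<lambda>t. p t * f t)"
proof -
  note [measurable] = L2_measurable[OF assms(1)]
  have "0 \<le> K" by (rule order_trans[OF norm_ge_zero K[of 0]])
  have "integrable lborel (\<lambda>t. (cmod (p t * f t))\<^sup>2)"
  proof (rule Bochner_Integration.integrable_bound)
    show "integrable lborel (\<lambda>t. K\<^sup>2 * (cmod (f t))\<^sup>2)"
      using assms by (simp add: L2_def)
    show "AE t in lborel. norm ((cmod (p t * f t))\<^sup>2) \<le> norm (K\<^sup>2 * (cmod (f t))\<^sup>2)"
      using K \<open>0 \<le> K\<close> by (auto simp: norm_mult power_mult_distrib intro!: mult_right_mono power_mono)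
  qed measurable
  then show ?thesis
    by (simp add: L2_def)
qed

lemma L2_cmult: "L2 f \<Longrightarrow> L2 (\<lambda>t. a * f t)"
  by (rule L2_bounded_mult[where K = "cmod a"]) auto

lemma L2_add:
  assumes "L2 f" "L2 h" shows "L2 (\<lambda>t. f t + h t)"
proof -
  note [measurable] = assms[THEN L2_measurable]
  have "integrable lborel (\<lambda>t. (cmod (f t + h t))\<^sup>2)"
  proof (rule Bochner_Integration.integrable_bound)
    show "integrable lborel (\<lambda>t. 2 * (cmod (f t))\<^sup>2 + 2 * (cmod (h t))\<^sup>2)"
      using assms by (simp add: L2_def)
    have "(cmod (f t + h t))\<^sup>2 \<le> 2 * (cmod (f t))\<^sup>2 + 2 * (cmod (h t))\<^sup>2" for t
    proof -
      have "(cmod (f t + h t))\<^sup>2 \<le> (cmod (f t) + cmod (h t))\<^sup>2"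
        by (intro power_mono norm_triangle_ineq) auto
      also have "\<dots> \<le> 2 * (cmod (f t))\<^sup>2 + 2 * (cmod (h t))\<^sup>2"
        using zero_le_power2[of "cmod (f t) - cmod (h t)"] by (simp add: power2_eq_square algebra_simps)
      finally show ?thesis .
    qed
    then show "AE t in lborel. norm ((cmod (f t + h t))\<^sup>2) \<le> norm (2 * (cmod (f t))\<^sup>2 + 2 * (cmod (h t))\<^sup>2)"
      by auto
  qed measurable
  then show ?thesis
    by (simp add: L2_def)
qed

lemma L2_diff:
  assumes "L2 f" "L2 h" shows "L2 (\<lambda>t. f t - h t)"
  using L2_add[OF assms(1) L2_cmult[OF assms(2), of "-1"]] by simp

lemma L2_sum: "(\<And>i. i \<in> G \<Longrightarrow> L2 (F i)) \<Longrightarrow> L2 (\<lambda>t. \<Sum>i\<in>G. F i t)"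
  by (induction G rule: infinite_finite_induct) (auto intro: L2_add)

lemma cnj_measurable [measurable]: "cnj \<in> borel_measurable borel"
  by (intro borel_measurable_continuous_onI continuous_intros)

lemma L2_cnj: "L2 f \<Longrightarrow> L2 (\<lambda>t. cnj (f t))"
  using measurable_compose[OF _ cnj_measurable, of f lborel] by (simp add: L2_def)

lemma l2norm_cong_AE:
  assumes "L2 f" "L2 h" "AE t in lborel. f t = h t" shows "l2norm f = l2norm h"
  unfolding l2norm_def using assms
  by (intro arg_cong[where f = sqrt] integral_cong_AE) (auto simp: L2_def)

lemma L2_mult_integrable:
  assumes "L2 f" "L2 h"
  shows "integrable lborel (\<lambda>t. f t * h t)"
proof (rule Bochner_Integration.integrable_bound)
  note [measurable] = assms[THEN L2_measurable]
  show "integrable lborel (\<lambda>t. (cmod (f t))\<^sup>2 + (cmod (h t))\<^sup>2)"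
    using assms by (simp add: L2_def)
  have "cmod (f t) * cmod (h t) \<le> (cmod (f t))\<^sup>2 + (cmod (h t))\<^sup>2" for t
  proof -
    have "0 \<le> cmod (f t) * cmod (h t)" by simp
    with sum_squares_bound[of "cmod (f t)" "cmod (h t)"] show ?thesis by linarith
  qed
  then show "AE t in lborel. norm (f t * h t) \<le> norm ((cmod (f t))\<^sup>2 + (cmod (h t))\<^sup>2)"
    by (auto simp: norm_mult)
  show "(\<lambda>t. f t * h t) \<in> borel_measurable lborel" by measurable
qed

text \<open>The pairing is bilinear. Where an inner product is meant, the conjugate is put into one
  factor by \<open>L2_cnj\<close>.\<close>

lemma L2_Cauchy_Schwarz_norm:
  assumes "L2 f" "L2 h"
  shows "(LINT t|lborel. cmod (f t * h t)) \<le> l2norm f * l2norm h"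
proof (rule power2_le_imp_le)
  note [measurable] = assms[THEN L2_measurable]
  have "ennreal ((LINT t|lborel. cmod (f t * h t))\<^sup>2) = (\<integral>\<^sup>+t. ennreal (cmod (f t)) * ennreal (cmod (h t)) \<partial>lborel)\<^sup>2"
    using integrable_norm[OF L2_mult_integrable[OF assms]]
    by (subst ennreal_power[symmetric], simp, subst nn_integral_eq_integral[symmetric])
       (auto simp: norm_mult ennreal_mult)
  also have "\<dots> \<le> (\<integral>\<^sup>+t. (ennreal (cmod (f t)))\<^sup>2 \<partial>lborel) * (\<integral>\<^sup>+t. (ennreal (cmod (h t)))\<^sup>2 \<partial>lborel)"
    by (rule Cauchy_Schwarz_nn_integral) measurable
  also have "\<dots> = ennreal ((l2norm f * l2norm h)\<^sup>2)"
    by (simp add: ennreal_power l2norm_square_nn[symmetric] assms power_mult_distrib ennreal_mult)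
  finally show "(LINT t|lborel. cmod (f t * h t))\<^sup>2 \<le> (l2norm f * l2norm h)\<^sup>2"
    by simp
qed simp

lemma L2_Cauchy_Schwarz:
  assumes "L2 f" "L2 h"
  shows "cmod (LINT t|lborel. f t * h t) \<le> l2norm f * l2norm h"
  by (rule order_trans[OF integral_norm_bound L2_Cauchy_Schwarz_norm[OF assms]])

lemma l2norm_triangle:
  assumes "L2 f" "L2 h"
  shows "l2norm (\<lambda>t. f t + h t) \<le> l2norm f + l2norm h"
proof (rule power2_le_imp_le)
  note L2_add[OF assms]
  have "(l2norm (\<lambda>t. f t + h t))\<^sup>2 \<le> (LINT t|lborel. (cmod (f t))\<^sup>2 + 2 * cmod (f t * h t) + (cmod (h t))\<^sup>2)"
    unfolding l2norm_square
  proof (rule integral_mono)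
    fix t
    have "(cmod (f t + h t))\<^sup>2 \<le> (cmod (f t) + cmod (h t))\<^sup>2"
      by (intro power_mono norm_triangle_ineq) auto
    then show "(cmod (f t + h t))\<^sup>2 \<le> (cmod (f t))\<^sup>2 + 2 * cmod (f t * h t) + (cmod (h t))\<^sup>2"
      by (simp add: power2_sum norm_mult)
  qed (use L2_add[OF assms] L2_mult_integrable[OF assms] assms in \<open>auto simp: L2_def\<close>)
  also have "\<dots> = (l2norm f)\<^sup>2 + 2 * (LINT t|lborel. cmod (f t * h t)) + (l2norm h)\<^sup>2"
    using L2_mult_integrable[OF assms] assms by (simp add: L2_def l2norm_square)
  also have "\<dots> \<le> (l2norm f + l2norm h)\<^sup>2"
    using L2_Cauchy_Schwarz_norm[OF assms] by (simp add: power2_sum)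
  finally show "(l2norm (\<lambda>t. f t + h t))\<^sup>2 \<le> (l2norm f + l2norm h)\<^sup>2" .
qed simp

lemma l2norm_cmult: "l2norm (\<lambda>t. a * f t) = cmod a * l2norm f"
  by (simp add: l2norm_def norm_mult power_mult_distrib real_sqrt_mult)

lemma l2norm_diff_commute: "l2norm (\<lambda>t. f t - h t) = l2norm (\<lambda>t. h t - f t)"
  by (simp add: l2norm_def norm_minus_commute)

lemma l2norm_diff_triangle:
  assumes "L2 f" "L2 h" "L2 k"
  shows "l2norm (\<lambda>t. f t - k t) \<le> l2norm (\<lambda>t. f t - h t) + l2norm (\<lambda>t. h t - k t)"
  using l2norm_triangle[OF L2_diff[OF assms(1,2)] L2_diff[OF assms(2,3)]] by simp

lemma l2norm_le_add_diff:
  assumes "L2 f" "L2 h"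
  shows "l2norm f \<le> l2norm h + l2norm (\<lambda>t. f t - h t)"
  using l2norm_triangle[OF assms(2) L2_diff[OF assms]] by simp

section \<open>Affine changes of variables and isometries of L2\<close>

lemma lborel_integral_affine:
  fixes f :: "'a::euclidean_space \<Rightarrow> 'b::{banach, second_countable_topology}"
  assumes [measurable]: "f \<in> borel_measurable borel" and c: "c \<noteq> 0"
  shows "(LINT x|lborel. f x) = \<bar>c\<bar> ^ DIM('a) *\<^sub>R (LINT x|lborel. f (t + c *\<^sub>R x))"
  by (subst lborel_affine[OF c, of t], subst integral_density) (auto simp: integral_distr)

lemma lborel_integrable_affine:
  fixes f :: "'a::euclidean_space \<Rightarrow> 'b::{banach, second_countable_topology}"
  assumes f: "integrable lborel f" and c: "c \<noteq> 0"
  shows "integrable lborel (\<lambda>x. f (t + c *\<^sub>R x))"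
proof -
  have [measurable]: "f \<in> borel_measurable borel" using f by auto
  have "integrable (density (distr lborel borel (\<lambda>x. t + c *\<^sub>R x)) (\<lambda>_. ennreal (\<bar>c\<bar>^DIM('a)))) f"
    using f lborel_affine[OF c, of t] by simp
  then have "integrable lborel (\<lambda>x. \<bar>c\<bar> ^ DIM('a) *\<^sub>R f (t + c *\<^sub>R x))"
    by (subst (asm) integrable_density) (auto simp: integrable_distr_eq)
  then have "integrable lborel (\<lambda>x. (1 / \<bar>c\<bar> ^ DIM('a)) *\<^sub>R (\<bar>c\<bar> ^ DIM('a) *\<^sub>R f (t + c *\<^sub>R x)))"
    by (rule integrable_scaleR_right)
  then show ?thesis
    using c by simp
qed

lemma lborel_integral_reflect_shift:
  fixes f :: "'a::euclidean_space \<Rightarrow> 'b::{banach, second_countable_topology}"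
  assumes "f \<in> borel_measurable borel"
  shows "(LINT x|lborel. f (a - x)) = (LINT x|lborel. f x)"
  using lborel_integral_affine[OF assms, of "-1" a] by simp

lemma lborel_integral_shift:
  fixes f :: "'a::euclidean_space \<Rightarrow> 'b::{banach, second_countable_topology}"
  assumes "f \<in> borel_measurable borel"
  shows "(LINT x|lborel. f (x - a)) = (LINT x|lborel. f x)"
  using lborel_integral_affine[OF assms, of "1" "-a"] by simp

lemma L2_transl: "L2 h \<Longrightarrow> L2 (transl l h)"
  unfolding L2_def transl_def
  using lborel_integrable_affine[of "\<lambda>t. (cmod (h t))\<^sup>2" 1 "-l"] by auto

lemma L2_reflect: "L2 h \<Longrightarrow> L2 (reflect h)"
  unfolding L2_def reflect_def
  using lborel_integrable_affine[of "\<lambda>t. (cmod (h t))\<^sup>2" "-1" 0] by auto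

lemma l2norm_transl: "L2 h \<Longrightarrow> l2norm (transl l h) = l2norm h"
  unfolding l2norm_def transl_def using lborel_integral_shift[of "\<lambda>t. (cmod (h t))\<^sup>2" l] by auto

lemma cmod_exp_imaginary [simp]:
  "cmod (exp (- (2 * of_real pi * \<i> * of_real r))) = 1" "cmod (exp (2 * of_real pi * \<i> * of_real r)) = 1"
  "cmod (exp (- (of_real pi * \<i> * of_real r))) = 1"
  by simp_all

lemma L2_tfshift:
  assumes "L2 h" shows "L2 (tfshift z h)"
proof -
  have "L2 (\<lambda>t. (exp (- (of_real pi * \<i> * of_real (pos z \<bullet> freq z)))
      * exp (2 * of_real pi * \<i> * of_real (freq z \<bullet> t))) * transl (pos z) h t)"
    by (rule L2_bounded_mult[where K=1]) (auto simp: norm_mult L2_transl assms)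
  then show ?thesis by (simp add: tfshift_def transl_def)
qed

text \<open>Riesz-Fischer for geometrically decaying increments, with an explicit rate. A weighted
  square sum of the increments gives pointwise convergence almost everywhere, and Fatou's lemma
  carries the tail estimate to the limit.\<close>

lemma L2_complete:
  fixes F :: "nat \<Rightarrow> 'd::finite sig"
  assumes F: "\<And>n. L2 (F n)" and D: "\<And>n. l2norm (\<lambda>t. F (Suc n) t - F n t) \<le> (1/2)^n"
  obtains f where "L2 f" "\<And>n. l2norm (\<lambda>t. f t - F n t) \<le> 2 * (1/2)^n"
proof -
  note [measurable] = F[THEN L2_measurable]
  \<comment> \<open>The subtracted term makes the induction exact: adding \<open>(1/2)^(n+k)\<close>
    to the bound for \<open>k\<close> gives the bound for \<open>Suc k\<close>.\<close>
  have tail: "l2norm (\<lambda>t. F (n + k) t - F n t) \<le> 2 * (1/2)^n - 2 * (1/2)^(n+k)" for n k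
  proof (induction k)
    case 0
    then show ?case by (simp add: l2norm_def)
  next
    case (Suc k)
    have "l2norm (\<lambda>t. F (n + Suc k) t - F n t)
        \<le> l2norm (\<lambda>t. F (Suc (n + k)) t - F (n + k) t) + l2norm (\<lambda>t. F (n + k) t - F n t)"
      using l2norm_diff_triangle[OF F F F] by simp
    also have "\<dots> \<le> (1/2)^(n+k) + (2 * (1/2)^n - 2 * (1/2)^(n+k))"
      using D[of "n+k"] Suc by (intro add_mono) auto
    finally show ?case by simp
  qed
  \<comment> \<open>The squared norm of the \<open>n\<close>-th increment is at most
    \<open>(1/4)^n\<close>, so the factor \<open>2^n\<close> still leaves a summable series. Its
    finiteness at \<open>t\<close> bounds the increment there by a constant times
    \<open>(1 / sqrt 2)^n\<close>.\<close>
  define W where "W n t = ennreal (2^n * (cmod (F (Suc n) t - F n t))\<^sup>2)" for n t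
  have [measurable]: "W n \<in> borel_measurable borel" for n
    unfolding W_def by measurable
  have "(\<integral>\<^sup>+t. W n t \<partial>lborel) \<le> ennreal ((1/2)^n)" for n
  proof -
    have "(\<integral>\<^sup>+t. W n t \<partial>lborel) = ennreal (2^n) * ennreal ((l2norm (\<lambda>t. F (Suc n) t - F n t))\<^sup>2)"
      unfolding W_def by (subst l2norm_square_nn[OF L2_diff[OF F F]])
        (simp add: ennreal_mult nn_integral_cmult)
    also have "\<dots> \<le> ennreal (2^n) * ennreal (((1/2)^n)\<^sup>2)"
      using D[of n] by (intro mult_left_mono ennreal_leI power_mono) auto
    also have "\<dots> = ennreal ((1/2)^n)"
      by (simp flip: ennreal_mult add: power2_eq_square power_divide)
    finally show ?thesis .
  qed
  then have "(\<Sum>n. \<integral>\<^sup>+t. W n t \<partial>lborel) \<le> (\<Sum>n. ennreal ((1/2)^n))"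
    by (intro suminf_le) auto
  also have "\<dots> < \<infinity>"
    by (subst suminf_ennreal2) (auto intro: summable_geometric)
  finally have "(\<integral>\<^sup>+t. (\<Sum>n. W n t) \<partial>lborel) < \<infinity>"
    by (subst nn_integral_suminf) auto
  then have "AE t in lborel. (\<Sum>n. W n t) \<noteq> \<infinity>"
    by (intro nn_integral_PInf_AE) auto
  then have conv: "AE t in lborel. convergent (\<lambda>n. F n t)"
  proof eventually_elim
    case (elim t)
    define K where "K = enn2real (\<Sum>n. W n t)"
    have K: "ennreal K = (\<Sum>n. W n t)" and "0 \<le> K"
      using elim by (auto simp: K_def less_top[symmetric])
    have bd: "cmod (F (Suc n) t - F n t) \<le> sqrt K * (1 / sqrt 2)^n" for n
    proof (rule power2_le_imp_le)
      have "W n t \<le> ennreal K"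
        unfolding K using sum_le_suminf[of "\<lambda>n. W n t" "{n}"] by auto
      then have "2^n * (cmod (F (Suc n) t - F n t))\<^sup>2 \<le> K"
        unfolding W_def using \<open>0 \<le> K\<close> by simp
      then show "(cmod (F (Suc n) t - F n t))\<^sup>2 \<le> (sqrt K * (1 / sqrt 2)^n)\<^sup>2"
        using \<open>0 \<le> K\<close> power_mult[of "sqrt 2" 2 n] power_mult[of "sqrt 2" n 2]
        by (simp add: power_mult_distrib power_divide field_simps)
    qed (use \<open>0 \<le> K\<close> in auto)
    have "summable (\<lambda>n. sqrt K * (1 / sqrt 2)^n)"
      by (intro summable_mult summable_geometric) auto
    then have "summable (\<lambda>n. F (Suc n) t - F n t)"
      by (rule summable_comparison_test'[where N=0]) (rule bd)
    then have "convergent (\<lambda>n. \<Sum>k<n. F (Suc k) t - F k t)"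
      by (simp add: summable_iff_convergent)
    then have "convergent (\<lambda>n. F n t - F 0 t)"
      by (simp add: sum_lessThan_telescope[of "\<lambda>n. F n t"])
    from convergent_add[OF this convergent_const[of "F 0 t"]] show ?case
      by simp
  qed
  \<comment> \<open>On the null set of divergence \<open>lim\<close> has an unspecified value, which
    no integral below sees.\<close>
  define f where "f t = lim (\<lambda>n. F n t)" for t
  have [measurable]: "f \<in> borel_measurable borel"
    unfolding f_def by measurable
  have bound: "(\<integral>\<^sup>+t. ennreal ((cmod (f t - F n t))\<^sup>2) \<partial>lborel) \<le> ennreal ((2 * (1/2)^n)\<^sup>2)" for n
  proof -
    have "(\<integral>\<^sup>+t. ennreal ((cmod (f t - F n t))\<^sup>2) \<partial>lborel)
        = (\<integral>\<^sup>+t. liminf (\<lambda>k. ennreal ((cmod (F (n + k) t - F n t))\<^sup>2)) \<partial>lborel)"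
    proof (rule nn_integral_cong_AE, use conv in eventually_elim)
      case (elim t)
      then have "(\<lambda>k. F k t) \<longlonglongrightarrow> f t"
        by (simp add: f_def convergent_LIMSEQ_iff)
      then have "(\<lambda>k. F (n + k) t) \<longlonglongrightarrow> f t"
        using LIMSEQ_ignore_initial_segment[of "\<lambda>k. F k t" "f t" n] by (simp add: add.commute)
      then have "(\<lambda>k. ennreal ((cmod (F (n + k) t - F n t))\<^sup>2)) \<longlonglongrightarrow> ennreal ((cmod (f t - F n t))\<^sup>2)"
        by (intro tendsto_intros)
      then show ?case
        by (intro lim_imp_Liminf[symmetric] trivial_limit_sequentially)
    qed
    also have "\<dots> \<le> liminf (\<lambda>k. \<integral>\<^sup>+t. ennreal ((cmod (F (n + k) t - F n t))\<^sup>2) \<partial>lborel)"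
      by (rule nn_integral_liminf) measurable
    also have "\<dots> \<le> liminf (\<lambda>k. ennreal ((2 * (1/2)^n)\<^sup>2))"
    proof (intro Liminf_mono always_eventually allI)
      fix k
      have "l2norm (\<lambda>t. F (n + k) t - F n t) \<le> 2 * (1/2)^n"
        by (rule order_trans[OF tail]) simp
      then show "(\<integral>\<^sup>+t. ennreal ((cmod (F (n + k) t - F n t))\<^sup>2) \<partial>lborel) \<le> ennreal ((2 * (1/2)^n)\<^sup>2)"
        unfolding l2norm_square_nn[OF L2_diff[OF F F], symmetric]
        by (intro ennreal_leI power_mono) auto
    qed
    finally show ?thesis by (simp add: Liminf_const)
  qed
  have *: "L2 (\<lambda>t. f t - F n t)" "l2norm (\<lambda>t. f t - F n t) \<le> 2 * (1/2)^n" for n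
    using l2norm_leI[OF _ bound[of n]] by auto
  have "L2 f"
    using L2_add[OF *(1)[of 0] F[of 0]] by simp
  with *(2) show thesis by (rule that[rotated])
qed

section \<open>The short-time Fourier transform of reflected shifts\<close>

lemma exp_2pi_i_int: "n \<in> \<int> \<Longrightarrow> exp (2 * of_real pi * \<i> * of_real n) = 1"
  using exp_integer_2pi[of "of_real n"] by (auto simp: mult_ac elim!: Ints_cases)

text \<open>Gives the symplectic form in the coordinates in which it appears as a phase below; the
  sign is fixed by the block \<open>-1\<close> in the upper right of \<open>Jmat\<close>.\<close>

lemma inner_Jmat: "u \<bullet> (Jmat *v z) = freq u \<bullet> pos z - pos u \<bullet> freq z"
proof -
  have sum: "(\<Sum>i\<in>UNIV. h i) = (\<Sum>k\<in>UNIV. h (Inl k)) + (\<Sum>k\<in>UNIV. h (Inr k))" for h :: "'a + 'a \<Rightarrow> real"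
    by (simp add: UNIV_Plus_UNIV[symmetric] sum.Plus del: UNIV_Plus_UNIV)
  have "(Jmat *v z) $ Inl k = - z $ Inr k" "(Jmat *v z) $ Inr k = z $ Inl k" for k
    by (simp_all add: matrix_vector_mult_def sum Jmat_def if_distrib[of "\<lambda>x. x * _"] cong: if_cong)
  then show ?thesis
    by (simp add: inner_vec_def sum pos_def freq_def sum_negf)
qed

lemma inner_matrix_vector_transpose:
  fixes S :: "real ^ 'n ^ 'm"
  shows "(S *v p) \<bullet> w = p \<bullet> (transpose S *v w)"
  by (metis dot_lmul_matrix inner_commute transpose_matrix_vector)

lemma symplectic_form_invariant:
  assumes "symplectic S"
  shows "freq (S *v p) \<bullet> pos (S *v q) - pos (S *v p) \<bullet> freq (S *v q) = freq p \<bullet> pos q - pos p \<bullet> freq q"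
proof -
  have "(S *v p) \<bullet> (Jmat *v (S *v q)) = p \<bullet> ((transpose S ** Jmat ** S) *v q)"
    by (simp only: inner_matrix_vector_transpose matrix_vector_mul_assoc matrix_mul_assoc)
  then show ?thesis
    using assms by (simp add: symplectic_def flip: inner_Jmat)
qed

text \<open>\<open>matrix_inv\<close> is a choice operator, so the inverse laws are extracted with
  \<open>someI_ex\<close>. They are phrased as cancellation on vectors, the shape in which lattice
  points and cells occur.\<close>

lemma matrix_inv_transpose:
  fixes A :: "real ^ 'd ^ 'd"
  assumes "invertible A"
  shows "transpose A *v (matrix_inv (transpose A) *v v) = v" "matrix_inv (transpose A) *v (transpose A *v v) = v"
    "invertible (matrix_inv (transpose A))"
proof -
  have "transpose A ** matrix_inv (transpose A) = mat 1 \<and> matrix_inv (transpose A) ** transpose A = mat 1"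
    unfolding matrix_inv_def
    using someI_ex[OF assms(1)[THEN transpose_invertible, unfolded invertible_def]] .
  then show "transpose A *v (matrix_inv (transpose A) *v v) = v" "matrix_inv (transpose A) *v (transpose A *v v) = v"
    "invertible (matrix_inv (transpose A))"
    by (auto simp: matrix_vector_mul_assoc invertible_def simp del: transpose_matrix_vector)
qed

text \<open>In the pairing of \<open>A v\<close> with \<open>A^{-T} w\<close> the matrices cancel
  and \<open>v \<bullet> w\<close> remains. This integrality serves twice: it trivialises the
  symplectic phase, and it makes trigonometric polynomials periodic along the dual lattice.\<close>

lemma inner_lattice_dual_lattice:
  assumes "invertible A" "m \<in> lattice A" "l \<in> dual_lattice A"
  shows "m \<bullet> l \<in> \<int>"
proof -
  obtain v w where v: "m = A *v v" "int_vec v" and w: "l = matrix_inv (transpose A) *v w" "int_vec w"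
    using assms by (auto simp: lattice_def dual_lattice_def)
  have "m \<bullet> l = v \<bullet> (transpose A *v (matrix_inv (transpose A) *v w))"
    unfolding v w by (simp only: inner_matrix_vector_transpose)
  also have "\<dots> = v \<bullet> w"
    by (simp only: matrix_inv_transpose(1)[OF assms(1)])
  also have "\<dots> \<in> \<int>"
    using v w by (auto simp: inner_vec_def int_vec_def)
  finally show ?thesis .
qed

text \<open>With this kernel the transform is a bilinear pairing of \<open>f\<close> with a fixed L2
  function, so linearity and continuity in \<open>f\<close> reduce to facts about products.\<close>

definition stft_kernel :: "'d::finite sig \<Rightarrow> real ^ ('d + 'd) \<Rightarrow> 'd sig" where
  "stft_kernel g z = (\<lambda>t. exp (- (2 * of_real pi * \<i> * of_real (freq z \<bullet> t))) * cnj (g (t - pos z)))"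

lemma stft_eq: "stft g f z = (LINT t|lborel. f t * stft_kernel g z t)"
  by (simp add: stft_def stft_kernel_def mult_ac)

lemma L2_stft_kernel: "L2 g \<Longrightarrow> L2 (stft_kernel g z)"
  unfolding stft_kernel_def
  using L2_cnj[OF L2_transl[of g "pos z"]] by (intro L2_bounded_mult[where K=1]) (auto simp: transl_def)

lemma stft_sum:
  assumes "L2 g" "\<And>m. m \<in> G \<Longrightarrow> L2 (F m)"
  shows "stft g (\<lambda>t. \<Sum>m\<in>G. c m * F m t) z = (\<Sum>m\<in>G. c m * stft g (F m) z)"
  using L2_mult_integrable[OF assms(2) L2_stft_kernel[OF assms(1)]]
  by (simp add: stft_eq sum_distrib_right mult.assoc Bochner_Integration.integral_sum)

lemma stft_cong_AE:
  assumes "L2 g" "L2 f" "L2 h" "AE t in lborel. f t = h t"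
  shows "stft g f z = stft g h z"
proof -
  note [measurable] = assms(2,3)[THEN L2_measurable] L2_measurable[OF L2_stft_kernel[OF assms(1)]]
  show ?thesis
    unfolding stft_eq using assms(4) by (intro integral_cong_AE) auto
qed

lemma stft_diff_le:
  assumes "L2 g" "L2 f" "L2 h"
  shows "cmod (stft g f z - stft g h z) \<le> l2dist f h * l2norm (stft_kernel g z)"
proof -
  note k = L2_stft_kernel[OF assms(1), of z]
  have "stft g f z - stft g h z = (LINT t|lborel. (f t - h t) * stft_kernel g z t)"
    using L2_mult_integrable[OF assms(2) k] L2_mult_integrable[OF assms(3) k]
    by (simp add: stft_eq left_diff_distrib)
  then show ?thesis
    using L2_Cauchy_Schwarz[OF L2_diff[OF assms(2,3)] k] by (simp add: l2dist_eq_l2norm)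
qed

text \<open>The integrand contains \<open>g (pos u - t)\<close> and the conjugate of
  \<open>g (t - pos z)\<close>. The point reflection through the midpoint of \<open>pos u\<close>
  and \<open>pos z\<close> swaps these two arguments, so it conjugates the integrand up to a
  phase.\<close>

lemma stft_tfshift_reflect:
  fixes g :: "'d::finite sig"
  assumes "L2 g"
  shows "stft g (tfshift u (reflect g)) z =
    exp (2 * of_real pi * \<i> * of_real (freq u \<bullet> pos z - pos u \<bullet> freq z)) *
    exp (- (2 * of_real pi * \<i> * of_real (pos z \<bullet> freq z))) * cnj (stft g (tfshift u (reflect g)) z)"
proof -
  define e where "e r = exp (2 * of_real pi * \<i> * of_real r)" for r :: real
  have e_add: "e (a + b) = e a * e b" for a b
    by (simp add: e_def distrib_left exp_add)
  have e_cnj: "cnj (e a) = e (- a)" for a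
    by (simp add: e_def exp_cnj)
  have [measurable]: "g \<in> borel_measurable borel" using assms by measurable
  have [measurable]: "e \<in> borel_measurable borel" unfolding e_def by measurable
  define p where "p = e (- (pos u \<bullet> freq u) / 2)"
  define q where "q t = g (pos u - t) * cnj (g (t - pos z)) * e (freq u \<bullet> t - freq z \<bullet> t)" for t
  have a: "stft g (tfshift u (reflect g)) z = p * (LINT t|lborel. q t)"
  proof -
    have "stft g (tfshift u (reflect g)) z = (LINT t|lborel. p * q t)"
      unfolding stft_def
    proof (intro Bochner_Integration.integral_cong refl)
      fix t
      have "exp (- (of_real pi * \<i> * of_real (pos u \<bullet> freq u))) = p"
        by (simp add: p_def e_def mult.assoc)
      moreover have "exp (- (2 * of_real pi * \<i> * of_real (freq z \<bullet> t))) = e (- (freq z \<bullet> t))"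
        by (simp add: e_def)
      ultimately show "tfshift u (reflect g) t * cnj (g (t - pos z)) * exp (- (2 * of_real pi * \<i> * of_real (freq z \<bullet> t))) = p * q t"
        using e_add[of "freq u \<bullet> t" "- (freq z \<bullet> t)"]
        by (simp add: tfshift_def reflect_def q_def e_def[of "freq u \<bullet> t"])
    qed
    then show ?thesis by simp
  qed
  have "(LINT t|lborel. q t) = (LINT t|lborel. q ((pos u + pos z) - t))"
    by (rule lborel_integral_reflect_shift[symmetric]) (unfold q_def, measurable)
  also have "\<dots> = (LINT t|lborel. e ((freq u - freq z) \<bullet> (pos u + pos z)) * cnj (q t))"
  proof (intro Bochner_Integration.integral_cong refl)
    fix t
    have "e (freq u \<bullet> (pos u + pos z - t) - freq z \<bullet> (pos u + pos z - t))
        = e ((freq u - freq z) \<bullet> (pos u + pos z)) * e (- (freq u \<bullet> t - freq z \<bullet> t))"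
      by (simp flip: e_add add: algebra_simps)
    then show "q (pos u + pos z - t) = e ((freq u - freq z) \<bullet> (pos u + pos z)) * cnj (q t)"
      by (simp add: q_def e_cnj)
  qed
  also have "\<dots> = e ((freq u - freq z) \<bullet> (pos u + pos z)) * cnj (LINT t|lborel. q t)"
    by simp
  finally have Q: "(LINT t|lborel. q t) = e ((freq u - freq z) \<bullet> (pos u + pos z)) * cnj (LINT t|lborel. q t)" .
  \<comment> \<open>Inserting \<open>p * cnj p\<close> completes the conjugate of the integral to
    the conjugate of the whole transform. The leftover \<open>p * p\<close> cancels the term
    \<open>freq u \<bullet> pos u\<close> produced by the reflection, so that only the symplectic
    form still depends on \<open>u\<close>.\<close>
  have "p * cnj p = 1"
    by (simp add: p_def e_cnj flip: e_add) (simp add: e_def)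
  then have "p * (LINT t|lborel. q t) = p * (p * cnj p) * (LINT t|lborel. q t)"
    by simp
  also have "\<dots> = p * e ((freq u - freq z) \<bullet> (pos u + pos z)) * p * cnj (p * (LINT t|lborel. q t))"
    by (subst Q) (simp only: mult_ac complex_cnj_mult)
  also have "p * e ((freq u - freq z) \<bullet> (pos u + pos z)) * p
      = e (freq u \<bullet> pos z - pos u \<bullet> freq z) * e (- (pos z \<bullet> freq z))"
    by (simp add: p_def flip: e_add) (simp add: algebra_simps inner_commute)
  finally show ?thesis
    by (simp only: a e_def of_real_minus mult_minus_right)
qed

section \<open>Gaussians\<close>

lemma Basis_real_vec: "(Basis :: (real ^ 'd) set) = range (\<lambda>i. axis i 1)"
  by (auto simp: Basis_vec_def)

text \<open>\<open>lborel\<close> is the image of a product measure indexed by \<open>Basis\<close>;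
  reindexing the basis by coordinates reduces product functions to one-dimensional integrals. Serves
  both the Gaussian and the characters on the unit cube.\<close>

lemma lborel_integral_prod:
  fixes f :: "'d::finite \<Rightarrow> real \<Rightarrow> complex"
  assumes f: "\<And>i. integrable lborel (f i)"
  shows "integrable lborel (\<lambda>x::real^'d. \<Prod>i\<in>UNIV. f i (x $ i))"
    and "(LINT x|lborel. (\<Prod>i\<in>UNIV. f i ((x::real^'d) $ i))) = (\<Prod>i\<in>UNIV. LINT x|lborel. f i x)"
proof -
  let ?ax = "\<lambda>i::'d. axis i (1::real)"
  have inj: "inj ?ax"
    by (auto simp: inj_on_def axis_eq_axis)
  have reindex: "(\<Prod>b\<in>Basis. h (inv ?ax b) b) = (\<Prod>i\<in>UNIV. h i (?ax i))" for h :: "'d \<Rightarrow> real^'d \<Rightarrow> complex"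
    unfolding Basis_real_vec by (subst prod.reindex[OF inj]) (simp add: inv_f_f[OF inj])
  have eq: "(\<Prod>i\<in>UNIV. f i (x $ i)) = (\<Prod>b\<in>Basis. f (inv ?ax b) (x \<bullet> b))" for x :: "real^'d"
    by (subst reindex[of "\<lambda>i b. f i (x \<bullet> b)"]) (simp add: inner_axis)
  have [measurable]: "f i \<in> borel_measurable borel" for i
    using f by auto
  interpret product_sigma_finite "\<lambda>_. lborel :: real measure" ..
  have eqB: "(\<Prod>b\<in>Basis. f (inv ?ax b) ((\<Sum>b\<in>Basis. g b *\<^sub>R b) \<bullet> b)) = (\<Prod>b\<in>Basis. f (inv ?ax b) (g b))" for g
    by (intro prod.cong refl arg_cong[where f = "f _"]) (rule inner_sum_left_Basis)
  have meas: "(\<lambda>x::real^'d. \<Prod>b\<in>Basis. f (inv ?ax b) (x \<bullet> b)) \<in> borel_measurable borel"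
    by measurable
  show "integrable lborel (\<lambda>x::real^'d. \<Prod>i\<in>UNIV. f i (x $ i))"
    unfolding eq
    by (subst lborel_eq, subst integrable_distr_eq)
      (use meas in \<open>auto simp: eqB intro!: product_integrable_prod f\<close>)
  have "(LINT x|lborel. (\<Prod>i\<in>UNIV. f i ((x::real^'d) $ i)))
      = (\<Prod>b\<in>(Basis::(real^'d) set). LINT x|lborel. f (inv ?ax b) x)"
    unfolding eq
    by (subst lborel_eq, subst integral_distr)
      (use meas in \<open>auto simp: eqB intro!: product_integral_prod f\<close>)
  also have "\<dots> = (\<Prod>i\<in>UNIV. LINT x|lborel. f i x)"
    by (rule reindex[of "\<lambda>i _. LINT x|lborel. f i x"])
  finally show "(LINT x|lborel. (\<Prod>i\<in>UNIV. f i ((x::real^'d) $ i))) = (\<Prod>i\<in>UNIV. LINT x|lborel. f i x)" .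
qed

lemma cis_measurable [measurable]: "cis \<in> borel_measurable borel"
  by (intro borel_measurable_continuous_onI continuous_intros)

definition gauss :: "'d::finite rvec \<Rightarrow> real" where
  "gauss x = (\<Prod>i\<in>UNIV. std_normal_density (x $ i))"

lemma gauss_eq: "gauss (x :: 'd::finite rvec) = exp (- (x \<bullet> x) / 2) / sqrt (2 * pi) ^ CARD('d)"
proof -
  have "exp (- (x \<bullet> x) / 2) = (\<Prod>i\<in>UNIV. exp (- (x $ i)\<^sup>2 / 2))"
    by (subst exp_sum[symmetric])
      (auto simp: inner_vec_def power2_eq_square sum_negf simp flip: sum_divide_distrib)
  then show ?thesis
    by (simp add: gauss_def std_normal_density_def prod_dividef)
qed

lemma gauss_pos: "0 < gauss x"
  by (simp add: gauss_eq)

lemma gauss_measurable [measurable]: "gauss \<in> borel_measurable borel"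
  unfolding gauss_eq by measurable

text \<open>In each coordinate the integral is the characteristic function of the standard normal
  distribution, which is \<open>sqrt (2 * pi)\<close> times its density. Integrability of
  \<open>gauss\<close> follows by taking the norm of the oscillating product.\<close>

lemma integrable_gauss: "integrable lborel (gauss :: 'd::finite rvec \<Rightarrow> real)"
  and gauss_fourier: "(LINT x|lborel. of_real (gauss x) * cis (v \<bullet> x))
      = of_real (sqrt (2 * pi) ^ CARD('d) * gauss (v :: 'd rvec))"
proof -
  define f where "f i x = of_real (std_normal_density x) * cis (v $ i * x)" for i x
  have f: "integrable lborel (f i)" for i
  proof (rule Bochner_Integration.integrable_bound)
    show "integrable lborel std_normal_density" by simp
    show "f i \<in> borel_measurable lborel"
      unfolding f_def[abs_def] by measurable
  qed (auto simp: f_def norm_mult)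
  have int: "(LINT x|lborel. f i x) = of_real (exp (- (v $ i)\<^sup>2 / 2))" for i
  proof -
    have "char std_normal_distribution (v $ i) = (LINT x|lborel. std_normal_density x *\<^sub>R iexp (v $ i * x))"
      unfolding char_def by (subst integral_density) auto
    then show ?thesis
      by (simp add: char_std_normal_distribution f_def scaleR_conv_of_real cis_conv_exp)
  qed
  have eq: "(\<Prod>i\<in>UNIV. f i (x $ i)) = of_real (gauss x) * cis (v \<bullet> x)" for x :: "'d rvec"
    by (simp add: f_def prod.distrib gauss_def inner_vec_def cis_conv_exp exp_sum sum_distrib_left)
  note * = lborel_integral_prod[of f, OF f, unfolded eq int]
  have "of_real (exp (- (v $ i)\<^sup>2 / 2)) = complex_of_real (sqrt (2*pi) * std_normal_density (v $ i))" for i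
    by (simp add: std_normal_density_def)
  then show "(LINT x|lborel. of_real (gauss x) * cis (v \<bullet> x))
      = of_real (sqrt (2 * pi) ^ CARD('d) * gauss (v :: 'd rvec))"
    using *(2) by (simp add: prod.distrib gauss_def)
  have "integrable lborel (\<lambda>x. norm (of_real (gauss x) * cis (v \<bullet> x)))"
    using *(1) by (rule integrable_norm)
  then show "integrable lborel (gauss :: 'd rvec \<Rightarrow> real)"
    by (simp add: norm_mult abs_of_pos[OF gauss_pos])
qed

lemma integral_gauss: "(LINT x|lborel. gauss (x :: 'd::finite rvec)) = 1"
proof -
  have "complex_of_real (LINT x|lborel. gauss (x :: 'd rvec)) = of_real (sqrt (2 * pi) ^ CARD('d) * gauss (0 :: 'd rvec))"
    using gauss_fourier[of "0 :: 'd rvec"] by simp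
  then show ?thesis
    by (simp add: gauss_eq flip: of_real_power)
qed

text \<open>The Gaussian weight used to regularise Plancherel's integral; its Fourier transform is the
  approximate identity \<open>\<epsilon>\<^sup>-\<^sup>d gauss (x / \<epsilon>)\<close>.\<close>

definition gauss_weight :: "real \<Rightarrow> 'd::finite rvec \<Rightarrow> real" where
  "gauss_weight \<epsilon> \<omega> = sqrt (2 * pi) ^ CARD('d) * gauss ((2 * pi * \<epsilon>) *\<^sub>R \<omega>)"

lemma gauss_weight_measurable [measurable]: "gauss_weight \<epsilon> \<in> borel_measurable borel"
  unfolding gauss_weight_def by measurable

lemma gauss_weight_eq: "gauss_weight \<epsilon> \<omega> = exp (- ((2 * pi * \<epsilon>)\<^sup>2 * (\<omega> \<bullet> \<omega>)) / 2)"
  by (simp add: gauss_weight_def gauss_eq power2_eq_square mult_ac)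

lemma integrable_gauss_weight: "\<epsilon> > 0 \<Longrightarrow> integrable lborel (gauss_weight \<epsilon>)"
  unfolding gauss_weight_def[abs_def]
  using lborel_integrable_affine[OF integrable_gauss, of "2 * pi * \<epsilon>" 0] by simp

lemma gauss_weight_fourier:
  fixes x :: "'d::finite rvec"
  assumes "\<epsilon> > 0"
  shows "(LINT \<omega>|lborel. of_real (gauss_weight \<epsilon> \<omega>) * cis (- (2 * pi * (\<omega> \<bullet> x))))
      = of_real (gauss ((1 / \<epsilon>) *\<^sub>R x) / \<epsilon> ^ CARD('d))"
proof -
  \<comment> \<open>This dilation removes the factor \<open>2 * pi * \<epsilon>\<close> inside
    \<open>gauss\<close>; per coordinate, its Jacobian combines with two factors
    \<open>sqrt (2 * pi)\<close> to \<open>1 / \<epsilon>\<close>.\<close>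
  define c where "c = 1 / (2 * pi * \<epsilon>)"
  have c: "c > 0" using assms by (simp add: c_def)
  have m: "(\<lambda>\<omega>. of_real (gauss_weight \<epsilon> \<omega>) * cis (- (2 * pi * (\<omega> \<bullet> x)))) \<in> borel_measurable borel"
    by measurable
  have "(LINT \<omega>|lborel. of_real (gauss_weight \<epsilon> \<omega>) * cis (- (2 * pi * (\<omega> \<bullet> x))))
    = c ^ CARD('d) *\<^sub>R (LINT \<omega>|lborel. of_real (gauss_weight \<epsilon> (c *\<^sub>R \<omega>)) * cis (- (2 * pi * ((c *\<^sub>R \<omega>) \<bullet> x))))"
    using c by (subst lborel_integral_affine[OF m, of c 0]) auto
  also have "\<dots> = c ^ CARD('d) *\<^sub>R (LINT \<omega>|lborel. of_real (sqrt (2 * pi) ^ CARD('d)) * (of_real (gauss \<omega>) * cis (((- 1 / \<epsilon>) *\<^sub>R x) \<bullet> \<omega>)))"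
  proof -
    have "(2 * pi * \<epsilon>) *\<^sub>R (c *\<^sub>R \<omega>) = \<omega>" for \<omega> :: "'d rvec"
      using assms by (simp add: c_def)
    moreover have "- (2 * pi * ((c *\<^sub>R \<omega>) \<bullet> x)) = ((- 1 / \<epsilon>) *\<^sub>R x) \<bullet> \<omega>" for \<omega>
      using assms by (simp add: c_def inner_commute)
    ultimately show ?thesis
      unfolding gauss_weight_def by (simp add: mult.assoc)
  qed
  also have "\<dots> = c ^ CARD('d) *\<^sub>R (of_real (sqrt (2 * pi) ^ CARD('d)) * of_real (sqrt (2 * pi) ^ CARD('d) * gauss ((- 1 / \<epsilon>) *\<^sub>R x)))"
    by (simp only: integral_mult_right_zero gauss_fourier)
  also have "\<dots> = of_real ((c * (sqrt (2 * pi) * sqrt (2 * pi))) ^ CARD('d) * gauss ((- 1 / \<epsilon>) *\<^sub>R x))"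
    by (simp only: scaleR_conv_of_real power_mult_distrib of_real_mult of_real_power mult_ac)
  also have "gauss ((- 1 / \<epsilon>) *\<^sub>R x) = gauss ((1 / \<epsilon>) *\<^sub>R x)"
    by (simp add: gauss_eq)
  also have "c * (sqrt (2 * pi) * sqrt (2 * pi)) = 1 / \<epsilon>"
    using assms by (simp add: c_def)
  finally show ?thesis
    by (simp add: power_divide)
qed

section \<open>The Fourier integral and Fubini with a product majorant\<close>

definition fourier :: "'d::finite sig \<Rightarrow> 'd sig" where
  "fourier f \<omega> = (LINT t|lborel. f t * cis (- (2 * pi * (\<omega> \<bullet> t))))"

lemma fourier_measurable [measurable]:
  assumes [measurable]: "f \<in> borel_measurable borel"
  shows "fourier f \<in> borel_measurable borel"
  unfolding fourier_def[abs_def] by measurable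

lemma norm_fourier_le: "cmod (fourier f \<omega>) \<le> (LINT t|lborel. cmod (f t))"
proof -
  have "cmod (fourier f \<omega>) \<le> (LINT t|lborel. cmod (f t * cis (- (2 * pi * (\<omega> \<bullet> t)))))"
    unfolding fourier_def by (rule integral_norm_bound)
  then show ?thesis by (simp add: norm_mult)
qed

lemma integrable_tensor:
  fixes f :: "'a::euclidean_space \<Rightarrow> real" and h :: "'b::euclidean_space \<Rightarrow> real"
  assumes "integrable lborel f" "integrable lborel h"
  shows "integrable (lborel \<Otimes>\<^sub>M lborel) (\<lambda>(x, y). f x * h y)"
proof -
  have [measurable]: "f \<in> borel_measurable borel" "h \<in> borel_measurable borel"
    using assms by auto
  show ?thesis
    by (rule lborel_pair.Fubini_integrable) (use assms in \<open>auto simp: abs_mult\<close>)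
qed

lemma Fubini_bounded:
  fixes F :: "'a::euclidean_space \<Rightarrow> 'b::euclidean_space \<Rightarrow> complex"
  assumes m: "(\<lambda>(x, y). F x y) \<in> borel_measurable (lborel \<Otimes>\<^sub>M lborel)"
    and f: "integrable lborel f" and h: "integrable lborel h"
    and le: "\<And>x y. cmod (F x y) \<le> f x * h y"
  shows "(LINT x|lborel. LINT y|lborel. F x y) = (LINT y|lborel. LINT x|lborel. F x y)"
proof -
  have "integrable (lborel \<Otimes>\<^sub>M lborel) (\<lambda>(x, y). F x y)"
  proof (rule Bochner_Integration.integrable_bound[OF integrable_tensor[OF f h] m])
    show "AE z in lborel \<Otimes>\<^sub>M lborel. norm (case z of (x, y) \<Rightarrow> F x y) \<le> norm (case z of (x, y) \<Rightarrow> f x * h y)"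
      using le by (auto intro!: AE_I2 order_trans[OF le])
  qed
  then show ?thesis
    by (rule lborel_pair.Fubini_integral[symmetric])
qed

section \<open>Plancherel's theorem\<close>

lemma l2norm_tendsto_0_dominated:
  fixes F :: "nat \<Rightarrow> 'd::finite sig"
  assumes [measurable]: "\<And>n. F n \<in> borel_measurable borel"
    and w: "integrable lborel w"
    and lim: "AE t in lborel. (\<lambda>n. F n t) \<longlonglongrightarrow> 0"
    and bound: "\<And>n t. (cmod (F n t))\<^sup>2 \<le> w t"
  shows "\<And>n. L2 (F n)" "(\<lambda>n. l2norm (F n)) \<longlonglongrightarrow> 0"
proof -
  show "L2 (F n)" for n
    unfolding L2_def using w
    by (auto intro!: Bochner_Integration.integrable_bound[OF w] AE_I2 order_trans[OF bound])
  have "(\<lambda>n. LINT t|lborel. (cmod (F n t))\<^sup>2) \<longlonglongrightarrow> (LINT t|(lborel :: 'd rvec measure). 0)"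
  proof (rule integral_dominated_convergence[OF _ _ w])
    show "AE t in lborel. (\<lambda>n. (cmod (F n t))\<^sup>2) \<longlonglongrightarrow> 0"
      using lim
    proof eventually_elim
      case (elim t)
      from tendsto_power[OF tendsto_norm[OF this], of 2] show ?case by simp
    qed
    show "AE t in lborel. norm ((cmod (F n t))\<^sup>2) \<le> w t" for n
      using bound by auto
  qed measurable
  from tendsto_real_sqrt[OF this] show "(\<lambda>n. l2norm (F n)) \<longlonglongrightarrow> 0"
    by (simp add: l2norm_def)
qed

section \<open>Density of continuous functions and continuity of translation in L2\<close>

lemma integrable_indicator_cball:
  "integrable lborel (\<lambda>t::'a::euclidean_space. K * indicator (cball 0 R) t :: real)"
  by (intro integrable_mult_right) (auto intro: emeasure_lborel_cball_finite simp: less_top[symmetric])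

lemma L2_truncation:
  assumes f: "L2 f" and "0 < e"
  obtains h :: "'d::finite sig" and M :: real where
    "L2 h" "0 < M" "\<And>t. cmod (h t) \<le> M" "\<And>t. norm t > M \<Longrightarrow> h t = 0" "l2norm (\<lambda>t. f t - h t) < e"
proof -
  note [measurable] = L2_measurable[OF f]
  define h where "h n t = (if cmod (f t) \<le> real (Suc n) \<and> norm t \<le> real (Suc n) then f t else 0)" for n :: nat and t
  have [measurable]: "h n \<in> borel_measurable borel" for n
    unfolding h_def by measurable
  have *: "L2 (\<lambda>t. f t - h n t)" "(\<lambda>n. l2norm (\<lambda>t. f t - h n t)) \<longlonglongrightarrow> 0" for n
  proof -
    have "(\<lambda>n. f t - h n t) \<longlonglongrightarrow> 0" for t
    proof (rule tendsto_eventually)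
      obtain N :: nat where "max (cmod (f t)) (norm t) \<le> real N"
        using real_arch_simple by blast
      then show "\<forall>\<^sub>F n in sequentially. f t - h n t = 0"
        by (intro eventually_sequentiallyI[of N]) (auto simp: h_def)
    qed
    then show "L2 (\<lambda>t. f t - h n t)" "(\<lambda>n. l2norm (\<lambda>t. f t - h n t)) \<longlonglongrightarrow> 0"
      using l2norm_tendsto_0_dominated[of "\<lambda>n t. f t - h n t" "\<lambda>t. (cmod (f t))\<^sup>2"] f
      by (auto simp: L2_def h_def)
  qed
  from order_tendstoD(2)[OF *(2) \<open>0 < e\<close>] obtain n where n: "l2norm (\<lambda>t. f t - h n t) < e"
    by (auto simp: eventually_sequentially)
  have "L2 (h n)"
    using L2_diff[OF f *(1)[of n]] by simp
  then show thesis
    by (rule that[of "h n" "real (Suc n)"]) (use n in \<open>auto simp: h_def\<close>)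
qed

text \<open>Measurability supplies continuous functions converging almost everywhere, but with no
  control of size or support. Clipping their values and cutting them off preserves continuity and
  the limit, and yields a common integrable majorant.\<close>

lemma L2_approx_continuous:
  assumes f: "L2 f" and "0 < e"
  obtains \<phi> :: "'d::finite sig" and R :: real where
    "continuous_on UNIV \<phi>" "L2 \<phi>" "\<And>t. norm t > R \<Longrightarrow> \<phi> t = 0" "l2norm (\<lambda>t. f t - \<phi> t) < e"
proof -
  obtain h :: "'d sig" and M where h: "L2 h" "0 < M" "\<And>t. cmod (h t) \<le> M" "\<And>t. norm t > M \<Longrightarrow> h t = 0"
      "l2norm (\<lambda>t. f t - h t) < e / 2"
    using L2_truncation[OF f, of "e/2"] \<open>0 < e\<close> by auto
  note [measurable] = L2_measurable[OF h(1)]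
  have "h measurable_on UNIV"
    by (intro lebesgue_measurable_imp_measurable_on measurable_completion) auto
  then obtain N k where N: "negligible N" and k: "\<And>n. continuous_on UNIV (k n)"
      and lim: "\<And>t. t \<notin> N \<Longrightarrow> (\<lambda>n. k n t) \<longlonglongrightarrow> h t"
    unfolding measurable_on_def by auto
  \<comment> \<open>The radial retraction onto the disc of radius \<open>M\<close>, which fixes all
    values of \<open>h\<close>.\<close>
  define clip where "clip z = of_real (M / max M (cmod z)) * z" for z
  \<comment> \<open>A cutoff equal to 1 on the ball of radius \<open>M\<close>, outside which
    \<open>h\<close> vanishes, and equal to 0 beyond radius \<open>M + 1\<close>.\<close>
  define \<kappa> where "\<kappa> t = max 0 (min 1 (M + 1 - norm t))" for t :: "'d rvec"
  define \<phi> where "\<phi> n t = of_real (\<kappa> t) * clip (k n t)" for n t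
  have clip_cont: "continuous_on UNIV clip"
    unfolding clip_def using h(2) by (intro continuous_intros) auto
  have clip_le: "cmod (clip z) \<le> M" for z
    using h(2) by (auto simp: clip_def norm_mult norm_divide field_simps max_def)
  have clip_id: "clip (h t) = h t" for t
    using h(2) h(3)[of t] by (simp add: clip_def max_def)
  have \<kappa>_cont: "continuous_on UNIV \<kappa>"
    unfolding \<kappa>_def by (intro continuous_intros)
  have \<phi>_cont: "continuous_on UNIV (\<phi> n)" for n
    unfolding \<phi>_def
    by (intro continuous_intros \<kappa>_cont continuous_on_compose2[OF clip_cont k]) auto
  note [measurable] = borel_measurable_continuous_onI[OF \<phi>_cont]
  have \<phi>_le: "cmod (\<phi> n t) \<le> M" for n t
  proof -
    have "cmod (\<phi> n t) = \<kappa> t * cmod (clip (k n t))"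
      by (simp add: \<phi>_def norm_mult \<kappa>_def)
    also have "\<dots> \<le> 1 * M"
      by (intro mult_mono clip_le) (auto simp: \<kappa>_def)
    finally show ?thesis by simp
  qed
  have \<phi>_0: "\<phi> n t = 0" if "norm t > M + 1" for n t
    using that by (simp add: \<phi>_def \<kappa>_def)
  have conv: "(\<lambda>n. h t - \<phi> n t) \<longlonglongrightarrow> 0" if "t \<notin> N" for t
  proof -
    have "(\<lambda>n. clip (k n t)) \<longlonglongrightarrow> clip (h t)"
      using clip_cont lim[OF that]
      by (auto intro!: isCont_tendsto_compose[of _ clip] simp: continuous_on_eq_continuous_at)
    then have "(\<lambda>n. h t - \<phi> n t) \<longlonglongrightarrow> h t - of_real (\<kappa> t) * clip (h t)"
      unfolding \<phi>_def by (intro tendsto_intros)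
    moreover have "of_real (\<kappa> t) * clip (h t) = h t"
      using h(4)[of t] by (cases "norm t > M") (auto simp: clip_id \<kappa>_def, simp add: clip_def)
    ultimately show ?thesis by simp
  qed
  have bound: "(cmod (h t - \<phi> n t))\<^sup>2 \<le> (2 * M)\<^sup>2 * indicator (cball 0 (M + 1)) t" for n t
  proof (cases "norm t > M + 1")
    case True
    then show ?thesis using h(4)[of t] \<phi>_0[of t n] by simp
  next
    case False
    have "cmod (h t - \<phi> n t) \<le> 2 * M"
      using norm_triangle_ineq4[of "h t" "\<phi> n t"] h(3)[of t] \<phi>_le[of n t] by linarith
    from power_mono[OF this norm_ge_zero, of 2] show ?thesis using False by simp
  qed
  have AE: "AE t in lborel. (\<lambda>n. h t - \<phi> n t) \<longlonglongrightarrow> 0"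
  proof -
    have "AE t in lebesgue. t \<notin> N"
      using N by (auto simp: negligible_iff_null_sets intro: AE_not_in)
    then have "AE t in lborel. t \<notin> N"
      by (simp add: AE_completion_iff)
    then show ?thesis
      by eventually_elim (rule conv)
  qed
  note * = l2norm_tendsto_0_dominated[OF _ integrable_indicator_cball AE bound]
  have "(\<lambda>n. l2norm (\<lambda>t. h t - \<phi> n t)) \<longlonglongrightarrow> 0"
    by (rule *(2)) measurable
  from order_tendstoD(2)[OF this, of "e/2"] \<open>0 < e\<close>
  obtain n where n: "l2norm (\<lambda>t. h t - \<phi> n t) < e / 2"
    by (auto simp: eventually_sequentially)
  have "L2 (\<lambda>t. h t - \<phi> n t)"
    by (rule *(1)) measurable
  from L2_diff[OF h(1) this] have \<phi>: "L2 (\<phi> n)"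
    by simp
  have "l2norm (\<lambda>t. f t - \<phi> n t) < e"
    using l2norm_diff_triangle[OF f h(1) \<phi>] h(5) n by linarith
  with \<phi>_cont \<phi> \<phi>_0 show thesis
    by (rule that)
qed

lemma continuous_compact_support_bounded:
  fixes \<phi> :: "'d::finite sig"
  assumes "continuous_on UNIV \<phi>" "\<And>t. norm t > R \<Longrightarrow> \<phi> t = 0"
  obtains B where "0 \<le> B" "\<And>t. cmod (\<phi> t) \<le> B"
proof -
  have "compact (\<phi> ` cball 0 R)"
    using assms(1) by (intro compact_continuous_image) (auto intro: continuous_on_subset)
  then have "bounded (\<phi> ` cball 0 R)"
    by (rule compact_imp_bounded)
  then obtain B where B: "\<forall>x\<in>\<phi> ` cball 0 R. cmod x \<le> B"
    unfolding bounded_iff ..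
  show thesis
  proof (rule that[of "max 0 B"])
    show "cmod (\<phi> t) \<le> max 0 B" for t
      using B assms(2)[of t] by (cases "norm t > R") (simp_all add: le_max_iff_disj)
  qed simp
qed

text \<open>For a continuous function of bounded support this is dominated convergence. Translation
  is an isometry, so the approximation error is the same for all shifts, and three errors of size
  \<open>e / 3\<close> add up.\<close>

lemma L2_translation_continuous:
  fixes f :: "'d::finite sig"
  assumes f: "L2 f" and X: "X \<longlonglongrightarrow> 0"
  shows "(\<lambda>n. l2norm (\<lambda>t. f t - transl (X n) f t)) \<longlonglongrightarrow> 0"
proof (rule LIMSEQ_I)
  fix e :: real assume "0 < e"
  obtain \<phi> R where \<phi>: "continuous_on UNIV \<phi>" "L2 \<phi>" "\<And>t. norm t > R \<Longrightarrow> \<phi> t = 0"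
      and app: "l2norm (\<lambda>t. f t - \<phi> t) < e / 3"
    using L2_approx_continuous[OF f, of "e/3"] \<open>0 < e\<close> by auto
  obtain B where B: "0 \<le> B" "\<And>t. cmod (\<phi> t) \<le> B"
    using continuous_compact_support_bounded[OF \<phi>(1,3)] by blast
  \<comment> \<open>A convergent sequence is bounded, so all the shifted copies of
    \<open>\<phi>\<close> vanish outside one ball of radius \<open>R + L\<close>.\<close>
  obtain L where L: "\<And>n. norm (X n) \<le> L"
    using convergent_imp_Bseq[OF convergentI[OF X]] by (auto simp: Bseq_def)
  note [measurable] = borel_measurable_continuous_onI[OF \<phi>(1)]
  have "(\<lambda>n. l2norm (\<lambda>t. \<phi> t - transl (X n) \<phi> t)) \<longlonglongrightarrow> 0"
  proof (rule l2norm_tendsto_0_dominated(2)[OF _ integrable_indicator_cball[of "(2 * B)\<^sup>2" "R + L"]])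
    show "(\<lambda>t. \<phi> t - transl (X n) \<phi> t) \<in> borel_measurable borel" for n
      unfolding transl_def by measurable
    have "(\<lambda>n. \<phi> t - transl (X n) \<phi> t) \<longlonglongrightarrow> 0" for t
    proof -
      have "(\<lambda>n. \<phi> (t - X n)) \<longlonglongrightarrow> \<phi> (t - 0)"
        using \<phi>(1) by (intro isCont_tendsto_compose[of _ \<phi>] tendsto_intros X)
          (auto simp: continuous_on_eq_continuous_at)
      from tendsto_diff[OF tendsto_const[of "\<phi> t"] this] show ?thesis
        by (simp add: transl_def)
    qed
    then show "AE t in lborel. (\<lambda>n. \<phi> t - transl (X n) \<phi> t) \<longlonglongrightarrow> 0"
      by simp
    show "(cmod (\<phi> t - transl (X n) \<phi> t))\<^sup>2 \<le> (2 * B)\<^sup>2 * indicator (cball 0 (R + L)) t" for n t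
    proof (cases "norm t > R + L")
      case True
      have "norm (t - X n) > R" "norm t > R"
        using True norm_triangle_ineq2[of t "X n"] L[of n] norm_ge_zero[of "X n"] by linarith+
      then show ?thesis using True by (simp add: transl_def \<phi>(3))
    next
      case False
      have "cmod (\<phi> t - transl (X n) \<phi> t) \<le> 2 * B"
        using norm_triangle_ineq4[of "\<phi> t" "\<phi> (t - X n)"] B(2)[of t] B(2)[of "t - X n"]
        by (simp add: transl_def)
      from power_mono[OF this norm_ge_zero, of 2] show ?thesis using False by simp
    qed
  qed
  from order_tendstoD(2)[OF this, of "e/3"] \<open>0 < e\<close> obtain N
    where N: "\<And>n. n \<ge> N \<Longrightarrow> l2norm (\<lambda>t. \<phi> t - transl (X n) \<phi> t) < e / 3"
    by (auto simp: eventually_sequentially)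
  show "\<exists>N. \<forall>n\<ge>N. norm (l2norm (\<lambda>t. f t - transl (X n) f t) - 0) < e"
  proof (intro exI allI impI)
    fix n assume "n \<ge> N"
    note T = L2_transl[OF f, of "X n"] L2_transl[OF \<phi>(2), of "X n"]
    have "(\<lambda>t. transl (X n) \<phi> t - transl (X n) f t) = transl (X n) (\<lambda>t. \<phi> t - f t)"
      by (simp add: transl_def)
    then have "l2norm (\<lambda>t. transl (X n) \<phi> t - transl (X n) f t) < e / 3"
      using app by (simp add: l2norm_transl[OF L2_diff[OF \<phi>(2) f]] l2norm_diff_commute[of f])
    then show "norm (l2norm (\<lambda>t. f t - transl (X n) f t) - 0) < e"
      using l2norm_diff_triangle[OF f \<phi>(2) T(1)] l2norm_diff_triangle[OF \<phi>(2) T(2,1)] app N[OF \<open>n \<ge> N\<close>]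
      by simp
  qed
qed

text \<open>Expanding \<open>|F f|^2\<close> as a double integral and integrating over the frequency
  first replaces the oscillation by a narrow Gaussian in \<open>s - t\<close>. What remains is a
  Gaussian average of the autocorrelation of \<open>f\<close>. The weight supplies the absolute
  convergence for the exchanges that involve the frequency.\<close>

lemma smoothed_Plancherel:
  fixes f :: "'d::finite sig"
  assumes f: "L2 f" and f1: "integrable lborel f" and "\<epsilon> > 0"
  shows "(LINT \<omega>|lborel. of_real (gauss_weight \<epsilon> \<omega> * (cmod (fourier f \<omega>))\<^sup>2))
    = (LINT u|lborel. of_real (gauss u) * (LINT s|lborel. f s * cnj (transl (\<epsilon> *\<^sub>R u) f s)))"
proof -
  note [measurable] = L2_measurable[OF f]
  define w where "w = (gauss_weight \<epsilon> :: 'd rvec \<Rightarrow> real)"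
  define E where "E \<omega> t = cis (- (2 * pi * (\<omega> \<bullet> t)))" for \<omega> t :: "'d rvec"
  define N where "N = (LINT t|lborel. cmod (f t))"
  have [measurable]: "w \<in> borel_measurable borel" unfolding w_def by measurable
  have [measurable]: "(\<lambda>x. E (a x) (b x)) \<in> borel_measurable M"
    if [measurable]: "a \<in> borel_measurable M" "b \<in> borel_measurable M" for a b and M :: "'x measure"
    unfolding E_def by measurable
  have F: "fourier f \<omega> = (LINT t|lborel. f t * E \<omega> t)" for \<omega>
    by (simp add: fourier_def E_def)
  have w: "integrable lborel w" "\<And>\<omega>. 0 \<le> w \<omega>"
    using integrable_gauss_weight[OF \<open>\<epsilon> > 0\<close>] by (auto simp: w_def gauss_weight_eq)
  have nf: "integrable lborel (\<lambda>t. cmod (f t))"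
    using f1 by (rule integrable_norm)
  have E1: "cmod (E \<omega> t) = 1" for \<omega> t by (simp add: E_def)
  have "(LINT \<omega>|lborel. complex_of_real (gauss_weight \<epsilon> \<omega> * (cmod (fourier f \<omega>))\<^sup>2))
      = (LINT \<omega>|lborel. LINT s|lborel. of_real (w \<omega>) * cnj (fourier f \<omega>) * (f s * E \<omega> s))"
  proof (rule Bochner_Integration.integral_cong[OF refl])
    fix \<omega> :: "'d rvec"
    have "complex_of_real (gauss_weight \<epsilon> \<omega> * (cmod (fourier f \<omega>))\<^sup>2) = of_real (w \<omega>) * cnj (fourier f \<omega>) * fourier f \<omega>"
      by (simp add: w_def complex_norm_square mult_ac del: of_real_power)
    then show "complex_of_real (gauss_weight \<epsilon> \<omega> * (cmod (fourier f \<omega>))\<^sup>2)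
        = (LINT s|lborel. of_real (w \<omega>) * cnj (fourier f \<omega>) * (f s * E \<omega> s))"
      by (simp add: F)
  qed
  \<comment> \<open>The conjugated transform is kept as one factor bounded by \<open>N\<close>, so
    Fubini in two variables suffices; its own integral is opened after \<open>s\<close> is
    fixed.\<close>
  also have "\<dots> = (LINT s|lborel. LINT \<omega>|lborel. of_real (w \<omega>) * cnj (fourier f \<omega>) * (f s * E \<omega> s))"
  proof (rule Fubini_bounded[OF _ integrable_mult_left[OF w(1)] nf])
    show "cmod (of_real (w \<omega>) * cnj (fourier f \<omega>) * (f s * E \<omega> s)) \<le> w \<omega> * N * cmod (f s)" for \<omega> s
      using w(2) norm_fourier_le[of f \<omega>]
      by (simp add: norm_mult E1 N_def mult_right_mono mult_left_mono)
  qed measurable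
  also have "\<dots> = (LINT s|lborel. LINT u|lborel. f s * (of_real (gauss u) * cnj (transl (\<epsilon> *\<^sub>R u) f s)))"
  proof (rule Bochner_Integration.integral_cong[OF refl])
    fix s
    define K where "K t = of_real (gauss ((1 / \<epsilon>) *\<^sub>R (s - t)) / \<epsilon> ^ CARD('d)) * cnj (f t)" for t
    have [measurable]: "K \<in> borel_measurable borel"
      unfolding K_def by measurable
    have "(LINT \<omega>|lborel. of_real (w \<omega>) * cnj (fourier f \<omega>) * (f s * E \<omega> s))
       = (LINT \<omega>|lborel. f s * (LINT t|lborel. of_real (w \<omega>) * E \<omega> s * cnj (E \<omega> t) * cnj (f t)))"
    proof (rule Bochner_Integration.integral_cong[OF refl])
      fix \<omega> :: "'d rvec"
      have "cnj (fourier f \<omega>) = (LINT t|lborel. cnj (E \<omega> t) * cnj (f t))"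
        unfolding F by (subst Bochner_Integration.integral_cnj[symmetric]) (simp only: complex_cnj_mult mult.commute)
      then show "of_real (w \<omega>) * cnj (fourier f \<omega>) * (f s * E \<omega> s)
        = f s * (LINT t|lborel. of_real (w \<omega>) * E \<omega> s * cnj (E \<omega> t) * cnj (f t))"
        by (simp add: mult.assoc mult.left_commute)
    qed
    also have "\<dots> = f s * (LINT \<omega>|lborel. LINT t|lborel. of_real (w \<omega>) * E \<omega> s * cnj (E \<omega> t) * cnj (f t))"
      by simp
    also have "(LINT \<omega>|lborel. LINT t|lborel. of_real (w \<omega>) * E \<omega> s * cnj (E \<omega> t) * cnj (f t))
        = (LINT t|lborel. LINT \<omega>|lborel. of_real (w \<omega>) * E \<omega> s * cnj (E \<omega> t) * cnj (f t))"
    proof (rule Fubini_bounded[OF _ w(1) nf])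
      show "cmod (of_real (w \<omega>) * E \<omega> s * cnj (E \<omega> t) * cnj (f t)) \<le> w \<omega> * cmod (f t)" for \<omega> t
        using w(2) by (simp add: norm_mult E1)
    qed measurable
    also have "\<dots> = (LINT t|lborel. K t)"
    proof (rule Bochner_Integration.integral_cong[OF refl])
      fix t
      have "E \<omega> s * cnj (E \<omega> t) = cis (- (2 * pi * (\<omega> \<bullet> (s - t))))" for \<omega>
        by (simp add: E_def cis_cnj cis_mult algebra_simps)
      then have "(LINT \<omega>|lborel. of_real (w \<omega>) * E \<omega> s * cnj (E \<omega> t) * cnj (f t))
        = (LINT \<omega>|lborel. of_real (w \<omega>) * cis (- (2 * pi * (\<omega> \<bullet> (s - t)))) * cnj (f t))"
        by (simp add: mult.assoc)
      also have "\<dots> = K t"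
        using gauss_weight_fourier[OF \<open>\<epsilon> > 0\<close>, of "s - t"] by (simp add: K_def w_def)
      finally show "(LINT \<omega>|lborel. of_real (w \<omega>) * E \<omega> s * cnj (E \<omega> t) * cnj (f t)) = K t" .
    qed
    \<comment> \<open>The substitution is \<open>t = s - \<epsilon> u\<close>; its Jacobian cancels
      the division by \<open>\<epsilon> ^ CARD('d)\<close> in \<open>K\<close>.\<close>
    also have "\<dots> = \<epsilon> ^ CARD('d) *\<^sub>R (LINT u|lborel. K (s + (- \<epsilon>) *\<^sub>R u))"
      using \<open>\<epsilon> > 0\<close> by (subst lborel_integral_affine[of K "- \<epsilon>" s]) auto
    also have "\<dots> = (LINT u|lborel. of_real (gauss u) * cnj (transl (\<epsilon> *\<^sub>R u) f s))"
      unfolding integral_scaleR_right[symmetric]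
      using \<open>\<epsilon> > 0\<close> by (simp add: K_def transl_def scaleR_conv_of_real[where 'a = complex])
    finally show "(LINT \<omega>|lborel. of_real (w \<omega>) * cnj (fourier f \<omega>) * (f s * E \<omega> s))
        = (LINT u|lborel. f s * (of_real (gauss u) * cnj (transl (\<epsilon> *\<^sub>R u) f s)))"
      by simp
  qed
  \<comment> \<open>Here the majorant comes from Cauchy-Schwarz: apart from \<open>gauss u\<close>,
    the inner integral of the norm is at most \<open>l2norm f * l2norm f\<close>, uniformly in the
    shift.\<close>
  also have "\<dots> = (LINT u|lborel. LINT s|lborel. f s * (of_real (gauss u) * cnj (transl (\<epsilon> *\<^sub>R u) f s)))"
  proof (rule lborel_pair.Fubini_integral)
    have m: "(\<lambda>(u, s). f s * (of_real (gauss u) * cnj (transl (\<epsilon> *\<^sub>R u) f s))) \<in> borel_measurable (lborel \<Otimes>\<^sub>M lborel)"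
      unfolding transl_def by measurable
    have i: "integrable lborel (\<lambda>s. f s * cnj (transl (\<epsilon> *\<^sub>R u) f s))" for u
      by (intro L2_mult_integrable f L2_cnj L2_transl)
    have norm_eq: "cmod (f s * (of_real (gauss u) * cnj (transl (\<epsilon> *\<^sub>R u) f s)))
        = gauss u * cmod (f s * cnj (transl (\<epsilon> *\<^sub>R u) f s))" for s u
      using gauss_pos[of u] by (simp add: norm_mult)
    have "integrable (lborel \<Otimes>\<^sub>M lborel) (\<lambda>(u, s). f s * (of_real (gauss u) * cnj (transl (\<epsilon> *\<^sub>R u) f s)))"
    proof (rule lborel_pair.Fubini_integrable[OF m])
      show "integrable lborel (\<lambda>u. LINT s|lborel. norm (case (u, s) of (u, s) \<Rightarrow>
          f s * (of_real (gauss u) * cnj (transl (\<epsilon> *\<^sub>R u) f s))))"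
      proof (rule Bochner_Integration.integrable_bound)
        show "integrable lborel (\<lambda>u::'d rvec. gauss u * (l2norm f * l2norm f) :: real)"
          by (intro integrable_mult_left integrable_gauss)
        show "(\<lambda>u. LINT s|lborel. norm (case (u, s) of (u, s) \<Rightarrow>
          f s * (of_real (gauss u) * cnj (transl (\<epsilon> *\<^sub>R u) f s)))) \<in> borel_measurable lborel"
          using m by measurable
        have "(LINT s|lborel. cmod (f s * cnj (transl (\<epsilon> *\<^sub>R u) f s))) \<le> l2norm f * l2norm f" for u
        proof -
          have "l2norm (\<lambda>s. cnj (transl (\<epsilon> *\<^sub>R u) f s)) = l2norm f"
            using l2norm_transl[OF f, of "\<epsilon> *\<^sub>R u"] by (simp add: l2norm_def)
          then show ?thesis
            using L2_Cauchy_Schwarz_norm[OF f L2_cnj[OF L2_transl[OF f, of "\<epsilon> *\<^sub>R u"]]] by simp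
        qed
        then show "AE u in lborel. norm (LINT s|lborel. norm (case (u, s) of (u, s) \<Rightarrow>
          f s * (of_real (gauss u) * cnj (transl (\<epsilon> *\<^sub>R u) f s)))) \<le> norm (gauss u * (l2norm f * l2norm f))"
          unfolding prod.case norm_eq
          by (intro AE_I2) (simp add: abs_mult abs_of_pos[OF gauss_pos] gauss_pos)
      qed
      show "AE u in lborel. integrable lborel (\<lambda>s. case (u, s) of (u, s) \<Rightarrow>
          f s * (of_real (gauss u) * cnj (transl (\<epsilon> *\<^sub>R u) f s)))"
      proof (intro AE_I2)
        show "integrable lborel (\<lambda>s. case (u, s) of (u, s) \<Rightarrow>
          f s * (of_real (gauss u) * cnj (transl (\<epsilon> *\<^sub>R u) f s)))" for u
          using integrable_mult_right[OF i, of "of_real (gauss u)" u] by (simp add: mult.left_commute)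
      qed
    qed
    then show "integrable (lborel \<Otimes>\<^sub>M lborel) (\<lambda>(u, s). f s * (of_real (gauss u) * cnj (transl (\<epsilon> *\<^sub>R u) f s)))" .
  qed
  also have "\<dots> = (LINT u|lborel. of_real (gauss u) * (LINT s|lborel. f s * cnj (transl (\<epsilon> *\<^sub>R u) f s)))"
    by (simp add: mult.left_commute[of "f _"])
  finally show ?thesis .
qed

text \<open>Let the width of the Gaussian tend to 0 in the smoothed identity. The autocorrelation
  \<open>r\<close> is bounded and continuous at 0, where it equals the squared norm of
  \<open>f\<close>, so the averages converge to that number.\<close>

lemma Plancherel:
  fixes f :: "'d::finite sig"
  assumes f: "L2 f" and f1: "integrable lborel f"
  shows "L2 (fourier f)" "l2norm (fourier f) = l2norm f"
proof -
  note [measurable] = L2_measurable[OF f]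
  define \<epsilon> where "\<epsilon> n = 1 / real (Suc n)" for n
  have \<epsilon>: "\<epsilon> n > 0" "\<epsilon> \<longlonglongrightarrow> 0" for n
    unfolding \<epsilon>_def using LIMSEQ_Suc[OF lim_1_over_n[where 'a = real]] by auto
  define F where "F = fourier f"
  define W where "W n \<omega> = gauss_weight (\<epsilon> n) \<omega> * (cmod (F \<omega>))\<^sup>2" for n \<omega>
  have [measurable]: "F \<in> borel_measurable borel" "W n \<in> borel_measurable borel" for n
    unfolding F_def W_def by measurable
  have weight: "0 \<le> gauss_weight (\<epsilon> n) \<omega>" "gauss_weight (\<epsilon> n) \<omega> \<le> 1"
      "(\<lambda>n. gauss_weight (\<epsilon> n) \<omega>) \<longlonglongrightarrow> 1" for n and \<omega> :: "'d rvec"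
  proof -
    show "0 \<le> gauss_weight (\<epsilon> n) \<omega>" "gauss_weight (\<epsilon> n) \<omega> \<le> 1"
      by (auto simp: gauss_weight_eq)
    have "(\<lambda>n. gauss_weight (\<epsilon> n) \<omega>) \<longlonglongrightarrow> exp (- ((2 * pi * 0)\<^sup>2 * (\<omega> \<bullet> \<omega>)) / 2)"
      unfolding gauss_weight_eq by (intro tendsto_intros \<epsilon>) auto
    then show "(\<lambda>n. gauss_weight (\<epsilon> n) \<omega>) \<longlonglongrightarrow> 1" by simp
  qed
  have W_lim: "(\<lambda>n. W n \<omega>) \<longlonglongrightarrow> (cmod (F \<omega>))\<^sup>2" for \<omega>
    using tendsto_mult[OF weight(3)[of \<omega>] tendsto_const] by (simp add: W_def)
  have W_int: "integrable lborel (W n)" for n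
  proof (rule Bochner_Integration.integrable_bound)
    show "integrable lborel (\<lambda>\<omega>::'d rvec. gauss_weight (\<epsilon> n) \<omega> * (LINT t|lborel. cmod (f t))\<^sup>2 :: real)"
      by (intro integrable_mult_left integrable_gauss_weight \<epsilon>)
    show "AE \<omega> in lborel. norm (W n \<omega>) \<le> norm (gauss_weight (\<epsilon> n) \<omega> * (LINT t|lborel. cmod (f t))\<^sup>2)"
      using weight(1) norm_fourier_le[of f]
      by (auto simp: W_def F_def abs_mult intro!: mult_left_mono power_mono)
  qed measurable
  define r where "r x = (LINT s|lborel. f s * cnj (transl x f s))" for x
  have [measurable]: "r \<in> borel_measurable borel"
    unfolding r_def transl_def by measurable
  have cnjT: "l2norm (\<lambda>s. cnj (transl x f s)) = l2norm f" for x
    using l2norm_transl[OF f, of x] by (simp add: l2norm_def)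
  have r_le: "cmod (r x) \<le> l2norm f * l2norm f" for x
    unfolding r_def using L2_Cauchy_Schwarz[OF f L2_cnj[OF L2_transl[OF f]], of x] by (simp add: cnjT)
  have r_cont: "(\<lambda>n. r (X n)) \<longlonglongrightarrow> r 0" if "X \<longlonglongrightarrow> 0" for X
  proof -
    have le: "cmod (r (X n) - r 0) \<le> l2norm f * l2norm (\<lambda>t. f t - transl (X n) f t)" for n
    proof -
      have "r 0 - r (X n) = (LINT s|lborel. f s * cnj (f s - transl (X n) f s))"
        unfolding r_def using L2_mult_integrable[OF f L2_cnj[OF L2_transl[OF f]]]
          L2_mult_integrable[OF f L2_cnj[OF f]]
        by (simp add: right_diff_distrib) (simp add: transl_def)
      then have "cmod (r 0 - r (X n)) \<le> l2norm f * l2norm (\<lambda>s. cnj (f s - transl (X n) f s))"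
        using L2_Cauchy_Schwarz[OF f L2_cnj[OF L2_diff[OF f L2_transl[OF f, of "X n"]]]] by simp
      also have "l2norm (\<lambda>s. cnj (f s - transl (X n) f s)) = l2norm (\<lambda>s. f s - transl (X n) f s)"
        unfolding l2norm_def complex_mod_cnj ..
      finally show ?thesis by (simp add: norm_minus_commute)
    qed
    have "(\<lambda>n. l2norm f * l2norm (\<lambda>t. f t - transl (X n) f t)) \<longlonglongrightarrow> 0"
      using tendsto_mult[OF tendsto_const[of "l2norm f"] L2_translation_continuous[OF f that]] by simp
    then have "(\<lambda>n. r (X n) - r 0) \<longlonglongrightarrow> 0"
      by (rule Lim_null_comparison[OF always_eventually[OF allI[OF le]]])
    then show ?thesis by (simp add: LIM_zero_iff)
  qed
  have "(\<lambda>n. LINT u|lborel. of_real (gauss u) * r (\<epsilon> n *\<^sub>R u)) \<longlonglongrightarrow> (LINT u|lborel. of_real (gauss (u :: 'd rvec)) * r 0)"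
  proof (rule integral_dominated_convergence)
    show "integrable lborel (\<lambda>u::'d rvec. gauss u * (l2norm f * l2norm f) :: real)"
      by (intro integrable_mult_left integrable_gauss)
    show "AE u in lborel. (\<lambda>n. of_real (gauss u) * r (\<epsilon> n *\<^sub>R u)) \<longlonglongrightarrow> of_real (gauss u) * r 0"
    proof (intro AE_I2 tendsto_intros r_cont)
      fix u :: "'d rvec"
      show "(\<lambda>n. \<epsilon> n *\<^sub>R u) \<longlonglongrightarrow> 0"
        using tendsto_scaleR[OF \<epsilon>(2) tendsto_const[of u]] by simp
    qed
    show "AE u in lborel. norm (of_real (gauss u) * r (\<epsilon> n *\<^sub>R u)) \<le> gauss u * (l2norm f * l2norm f)" for n
      using r_le by (intro AE_I2) (simp add: norm_mult abs_of_pos[OF gauss_pos] gauss_pos)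
  qed measurable
  also have "(LINT u|lborel. of_real (gauss (u :: 'd rvec)) * r 0) = r 0"
    by (simp add: integral_gauss)
  also have "r 0 = of_real ((l2norm f)\<^sup>2)"
    unfolding r_def l2norm_square by (simp add: transl_def flip: complex_norm_square of_real_power)
  also have "(\<lambda>n. LINT u|lborel. of_real (gauss u) * r (\<epsilon> n *\<^sub>R u)) = (\<lambda>n. of_real (LINT \<omega>|lborel. W n \<omega>))"
    using smoothed_Plancherel[OF f f1 \<epsilon>(1)] by (simp add: r_def W_def F_def del: of_real_mult of_real_power)
  finally have lim: "(\<lambda>n. LINT \<omega>|lborel. W n \<omega>) \<longlonglongrightarrow> (l2norm f)\<^sup>2"
    by (simp only: tendsto_of_real_iff)
  \<comment> \<open>Fatou's lemma has to give square integrability first; only then is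
    \<open>(cmod (F \<omega>))^2\<close> available as a majorant, and dominated convergence yields
    the equality of norms.\<close>
  have "(\<integral>\<^sup>+\<omega>. ennreal ((cmod (F \<omega>))\<^sup>2) \<partial>lborel) = (\<integral>\<^sup>+\<omega>. liminf (\<lambda>n. ennreal (W n \<omega>)) \<partial>lborel)"
    by (intro nn_integral_cong lim_imp_Liminf[symmetric] tendsto_ennrealI W_lim trivial_limit_sequentially)
  also have "\<dots> \<le> liminf (\<lambda>n. \<integral>\<^sup>+\<omega>. ennreal (W n \<omega>) \<partial>lborel)"
    by (rule nn_integral_liminf) measurable
  also have "\<dots> = liminf (\<lambda>n. ennreal (LINT \<omega>|lborel. W n \<omega>))"
    using weight(1) by (subst nn_integral_eq_integral[OF W_int]) (auto simp: W_def)
  also have "\<dots> = ennreal ((l2norm f)\<^sup>2)"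
    by (intro lim_imp_Liminf tendsto_ennrealI lim trivial_limit_sequentially)
  finally have "L2 F"
    using l2norm_leI(1)[of F "l2norm f"] by simp
  have "(\<lambda>n. LINT \<omega>|lborel. W n \<omega>) \<longlonglongrightarrow> (LINT \<omega>|lborel. (cmod (F \<omega>))\<^sup>2)"
  proof (rule integral_dominated_convergence[where w = "\<lambda>\<omega>. (cmod (F \<omega>))\<^sup>2"])
    show "AE \<omega> in lborel. norm (W n \<omega>) \<le> (cmod (F \<omega>))\<^sup>2" for n
      using weight(1,2) by (auto simp: W_def abs_mult intro!: mult_left_le_one_le)
  qed (use \<open>L2 F\<close> W_lim in \<open>auto simp: L2_def\<close>)
  from LIMSEQ_unique[OF this lim] have "(l2norm F)\<^sup>2 = (l2norm f)\<^sup>2"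
    by (simp add: l2norm_square)
  then show "l2norm (fourier f) = l2norm f"
    by (simp add: F_def)
  show "L2 (fourier f)"
    using \<open>L2 F\<close> by (simp add: F_def)
qed

section \<open>The Bessel inequality for lattice translates\<close>

lemma l2norm_sum_le:
  assumes "\<And>i. i \<in> G \<Longrightarrow> L2 (F i)"
  shows "l2norm (\<lambda>t. \<Sum>i\<in>G. F i t) \<le> (\<Sum>i\<in>G. l2norm (F i))"
  using assms
proof (induction G rule: infinite_finite_induct)
  case (insert i G)
  have "l2norm (\<lambda>t. F i t + (\<Sum>i\<in>G. F i t)) \<le> l2norm (F i) + l2norm (\<lambda>t. \<Sum>i\<in>G. F i t)"
    using insert.prems by (intro l2norm_triangle L2_sum) auto
  with insert show ?case by simp
qed (auto simp: l2norm_def)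

lemma l2norm_bounded_mult:
  assumes f: "L2 f" and p: "p \<in> borel_measurable borel" and K: "\<And>t. cmod (p t) \<le> K"
  shows "l2norm (\<lambda>t. p t * f t) \<le> K * l2norm f"
proof -
  have "0 \<le> K" by (rule order_trans[OF norm_ge_zero K[of 0]])
  have "(l2norm (\<lambda>t. p t * f t))\<^sup>2 \<le> (LINT t|lborel. K\<^sup>2 * (cmod (f t))\<^sup>2)"
    unfolding l2norm_square
    using L2_bounded_mult[OF assms] f K \<open>0 \<le> K\<close>
    by (intro integral_mono)
      (auto simp: L2_def norm_mult power_mult_distrib intro!: mult_right_mono power_mono)
  also have "\<dots> = (K * l2norm f)\<^sup>2"
    by (simp add: l2norm_square power_mult_distrib)
  finally show ?thesis
    by (rule power2_le_imp_le) (simp add: \<open>0 \<le> K\<close>)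
qed

section \<open>Finite sums of translates as Fourier multipliers\<close>

lemma fourier_transl:
  assumes "h \<in> borel_measurable borel"
  shows "fourier (transl m h) \<omega> = cis (- (2 * pi * (\<omega> \<bullet> m))) * fourier h \<omega>"
proof -
  note [measurable] = assms
  have "fourier (transl m h) \<omega> = (LINT t|lborel. (\<lambda>t. h t * cis (- (2 * pi * (\<omega> \<bullet> (t + m))))) (t - m))"
    by (simp add: fourier_def transl_def)
  also have "\<dots> = (LINT t|lborel. h t * cis (- (2 * pi * (\<omega> \<bullet> (t + m)))))"
    by (rule lborel_integral_shift) measurable
  also have "\<dots> = (LINT t|lborel. cis (- (2 * pi * (\<omega> \<bullet> m))) * (h t * cis (- (2 * pi * (\<omega> \<bullet> t)))))"
    by (intro Bochner_Integration.integral_cong refl)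
      (simp add: mult.left_commute cis_mult inner_add_right algebra_simps)
  finally show ?thesis by (simp add: fourier_def)
qed

lemma fourier_sum:
  assumes "\<And>i. i \<in> G \<Longrightarrow> integrable lborel (F i)"
  shows "fourier (\<lambda>t. \<Sum>i\<in>G. c i * F i t) \<omega> = (\<Sum>i\<in>G. c i * fourier (F i) \<omega>)"
proof -
  have "integrable lborel (\<lambda>t. F i t * cis (- (2 * pi * (\<omega> \<bullet> t))))" if "i \<in> G" for i
  proof (rule Bochner_Integration.integrable_bound[OF assms[OF that]])
    have [measurable]: "F i \<in> borel_measurable borel" using assms[OF that] by auto
    show "(\<lambda>t. F i t * cis (- (2 * pi * (\<omega> \<bullet> t)))) \<in> borel_measurable lborel" by measurable
  qed (auto simp: norm_mult)
  then show ?thesis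
    by (simp add: fourier_def sum_distrib_right mult.assoc)
qed

text \<open>The Fourier multiplier of the operator taking \<open>h\<close> to the sum of the
  \<open>c m * transl m h\<close>.\<close>

definition trig_poly :: "'d::finite rvec set \<Rightarrow> ('d rvec \<Rightarrow> complex) \<Rightarrow> 'd sig" where
  "trig_poly G c \<omega> = (\<Sum>m\<in>G. c m * cis (- (2 * pi * (\<omega> \<bullet> m))))"

lemma trig_poly_measurable [measurable]: "trig_poly G c \<in> borel_measurable borel"
  unfolding trig_poly_def[abs_def] by measurable

lemma norm_trig_poly_le: "cmod (trig_poly G c \<omega>) \<le> (\<Sum>m\<in>G. cmod (c m))"
  unfolding trig_poly_def by (rule order_trans[OF norm_sum]) (simp add: norm_mult)

text \<open>\<open>H\<close> is reached only through truncations of \<open>\<psi>\<close>; these are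
  integrable, so Plancherel applies to them. The errors on both sides are multiplied by the sum of
  the \<open>cmod (c m)\<close>, which depends on \<open>G\<close>, but \<open>G\<close> stays fixed
  in the limit.\<close>

lemma l2norm_translates_le:
  fixes \<psi> :: "'d::finite sig"
  assumes \<psi>: "L2 \<psi>" and H: "is_L2_fourier \<psi> H"
  shows "l2norm (\<lambda>t. \<Sum>m\<in>G. c m * transl m \<psi> t) \<le> l2norm (\<lambda>\<omega>. trig_poly G c \<omega> * H \<omega>)"
proof -
  note [measurable] = L2_measurable[OF \<psi>]
  let ?T = "\<lambda>h t. \<Sum>m\<in>G. c m * transl m h t" and ?P = "trig_poly G c"
  have L2H: "L2 H" and Hlim: "((\<lambda>R. l2dist H (fourier_trunc R \<psi>)) \<longlongrightarrow> 0) at_top"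
    using H by (auto simp: is_L2_fourier_def)
  define K where "K = (\<Sum>m\<in>G. cmod (c m))"
  \<comment> \<open>The cubes of \<open>fourier_trunc\<close>, so that the Fourier integral of
    \<open>\<psi>n n\<close> is literally \<open>fourier_trunc (real n) \<psi>\<close>.\<close>
  define Q where "Q n = {s :: 'd rvec. \<forall>i. \<bar>s $ i\<bar> \<le> real n}" for n
  have [measurable]: "Q n \<in> sets borel" for n
    unfolding Q_def by measurable
  define \<psi>n where "\<psi>n n t = indicator (Q n) t * \<psi> t" for n t
  have L2n: "L2 (\<psi>n n)" for n
    unfolding \<psi>n_def by (rule L2_bounded_mult[OF \<psi>, where K=1]) (auto simp: indicator_def)
  have Q_sub: "Q n = cbox (\<chi> i. - real n) (\<chi> i. real n)" for n
    by (auto simp: Q_def mem_box_cart abs_le_iff minus_le_iff)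
  have L1n: "integrable lborel (\<psi>n n)" for n
  proof -
    have "integrable lborel (indicator (Q n) :: 'd rvec \<Rightarrow> real)"
      unfolding Q_sub by (auto simp: less_top[symmetric] intro!: emeasure_bounded_finite)
    \<comment> \<open>The indicator of a bounded cube is itself in L2, so the truncation is a
      product of two L2 functions and hence integrable.\<close>
    then have "L2 (indicator (Q n))"
      unfolding L2_def
      by (auto elim!: Bochner_Integration.integrable_cong[THEN iffD1, rotated 2] simp: indicator_def)
    from L2_mult_integrable[OF this \<psi>] show ?thesis
      by (simp add: \<psi>n_def[abs_def])
  qed
  have trunc: "fourier (\<psi>n n) = fourier_trunc (real n) \<psi>" for n
    by (rule ext) (simp add: fourier_def fourier_trunc_def \<psi>n_def Q_def cis_conv_exp mult_ac)
  have Tdiff: "l2norm (\<lambda>t. ?T \<psi> t - ?T (\<psi>n n) t) \<le> K * l2norm (\<lambda>t. \<psi> t - \<psi>n n t)" for n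
  proof -
    have "l2norm (\<lambda>t. ?T \<psi> t - ?T (\<psi>n n) t) = l2norm (\<lambda>t. \<Sum>m\<in>G. c m * transl m (\<lambda>t. \<psi> t - \<psi>n n t) t)"
      by (simp add: transl_def right_diff_distrib sum_subtractf)
    also have "\<dots> \<le> (\<Sum>m\<in>G. l2norm (\<lambda>t. c m * transl m (\<lambda>t. \<psi> t - \<psi>n n t) t))"
      by (intro l2norm_sum_le L2_cmult L2_transl L2_diff \<psi> L2n)
    also have "\<dots> = K * l2norm (\<lambda>t. \<psi> t - \<psi>n n t)"
      by (simp add: l2norm_cmult l2norm_transl L2_diff \<psi> L2n K_def sum_distrib_right)
    finally show ?thesis .
  qed
  have L2T: "L2 (?T h)" if "L2 h" for h
    using that by (intro L2_sum L2_cmult L2_transl)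
  have planch: "l2norm (?T (\<psi>n n)) = l2norm (\<lambda>\<omega>. ?P \<omega> * fourier (\<psi>n n) \<omega>)" and L2F: "L2 (fourier (\<psi>n n))" for n
  proof -
    have i: "integrable lborel (transl m (\<psi>n n))" for m
      unfolding transl_def using lborel_integrable_affine[OF L1n[of n], of 1 "-m"] by simp
    then have "integrable lborel (?T (\<psi>n n))"
      by (intro Bochner_Integration.integrable_sum integrable_mult_right)
    from Plancherel(2)[OF L2T[OF L2n] this]
    have "l2norm (?T (\<psi>n n)) = l2norm (fourier (?T (\<psi>n n)))" by simp
    also have "fourier (?T (\<psi>n n)) = (\<lambda>\<omega>. ?P \<omega> * fourier (\<psi>n n) \<omega>)"
      using L2_measurable[OF L2n]
      by (intro ext) (simp add: fourier_sum[OF i] fourier_transl trig_poly_def sum_distrib_right mult.assoc)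
    finally show "l2norm (?T (\<psi>n n)) = l2norm (\<lambda>\<omega>. ?P \<omega> * fourier (\<psi>n n) \<omega>)" .
    show "L2 (fourier (\<psi>n n))"
      by (rule Plancherel(1)[OF L2n L1n])
  qed
  have step: "l2norm (?T \<psi>) \<le> l2norm (\<lambda>\<omega>. ?P \<omega> * H \<omega>) + K * l2dist H (fourier_trunc (real n) \<psi>)
      + K * l2norm (\<lambda>t. \<psi> t - \<psi>n n t)" for n
  proof -
    have PH: "L2 (\<lambda>\<omega>. ?P \<omega> * h \<omega>)" if "L2 h" for h
      using that by (rule L2_bounded_mult[OF _ _ norm_trig_poly_le]) measurable
    have "l2norm (?T \<psi>) \<le> l2norm (?T (\<psi>n n)) + l2norm (\<lambda>t. ?T \<psi> t - ?T (\<psi>n n) t)"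
      by (intro l2norm_le_add_diff L2T \<psi> L2n)
    also have "l2norm (?T (\<psi>n n)) \<le> l2norm (\<lambda>\<omega>. ?P \<omega> * H \<omega>)
        + l2norm (\<lambda>\<omega>. ?P \<omega> * fourier (\<psi>n n) \<omega> - ?P \<omega> * H \<omega>)"
      unfolding planch by (intro l2norm_le_add_diff PH L2H L2F)
    also have "l2norm (\<lambda>\<omega>. ?P \<omega> * fourier (\<psi>n n) \<omega> - ?P \<omega> * H \<omega>)
        = l2norm (\<lambda>\<omega>. ?P \<omega> * (fourier (\<psi>n n) \<omega> - H \<omega>))"
      by (simp add: right_diff_distrib)
    also have "\<dots> \<le> K * l2norm (\<lambda>\<omega>. fourier (\<psi>n n) \<omega> - H \<omega>)"
      unfolding K_def by (intro l2norm_bounded_mult L2_diff L2F L2H norm_trig_poly_le) measurable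
    also have "l2norm (\<lambda>\<omega>. fourier (\<psi>n n) \<omega> - H \<omega>) = l2dist H (fourier_trunc (real n) \<psi>)"
      by (simp add: l2dist_eq_l2norm trunc l2norm_diff_commute[of H])
    finally show ?thesis
      using Tdiff[of n] by simp
  qed
  have "(\<lambda>n. l2dist H (fourier_trunc (real n) \<psi>)) \<longlonglongrightarrow> 0"
    using Hlim filterlim_real_sequentially by (rule filterlim_compose)
  moreover have "(\<lambda>n. l2norm (\<lambda>t. \<psi> t - \<psi>n n t)) \<longlonglongrightarrow> 0"
  proof (rule l2norm_tendsto_0_dominated(2)[where w = "\<lambda>t. (cmod (\<psi> t))\<^sup>2"])
    show "(\<lambda>t. \<psi> t - \<psi>n n t) \<in> borel_measurable borel" for n
      using L2_measurable[OF L2n] by measurable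
    have "(\<lambda>n. \<psi> t - \<psi>n n t) \<longlonglongrightarrow> 0" for t
    proof (rule tendsto_eventually)
      obtain N :: nat where N: "norm t \<le> real N"
        using real_arch_simple by blast
      show "\<forall>\<^sub>F n in sequentially. \<psi> t - \<psi>n n t = 0"
      proof (rule eventually_sequentiallyI[of N])
        fix n assume "n \<ge> N"
        then have "\<bar>t $ i\<bar> \<le> real n" for i
          using N component_le_norm_cart[of t i] by linarith
        then show "\<psi> t - \<psi>n n t = 0"
          by (simp add: \<psi>n_def Q_def)
      qed
    qed
    then show "AE t in lborel. (\<lambda>n. \<psi> t - \<psi>n n t) \<longlonglongrightarrow> 0" by simp
  qed (use \<psi> in \<open>auto simp: L2_def \<psi>n_def indicator_def\<close>)
  ultimately have "(\<lambda>n. l2norm (\<lambda>\<omega>. ?P \<omega> * H \<omega>) + K * l2dist H (fourier_trunc (real n) \<psi>)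
      + K * l2norm (\<lambda>t. \<psi> t - \<psi>n n t)) \<longlonglongrightarrow> l2norm (\<lambda>\<omega>. ?P \<omega> * H \<omega>) + K * 0 + K * 0"
    by (intro tendsto_intros)
  then show ?thesis
    using step by (intro LIMSEQ_le_const) auto
qed

text \<open>Links the unordered sum in \<open>periodization\<close> to an integral over counting
  measure, where Tonelli's theorem can exchange it with \<open>lborel\<close>.\<close>

lemma nn_integral_count_space_le_infsum:
  fixes f :: "'a \<Rightarrow> ennreal"
  assumes "countable I"
  shows "(\<integral>\<^sup>+i. f i \<partial>count_space I) \<le> infsum f I"
proof (cases "finite I")
  case True
  then show ?thesis by (simp add: nn_integral_count_space_finite)
next
  case False
  let ?b = "from_nat_into I"
  have b: "bij_betw ?b UNIV I"
    using assms False by (rule bij_betw_from_nat_into)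
  have "(\<integral>\<^sup>+i. f i \<partial>count_space I) = (\<Sum>n. f (?b n))"
    using nn_integral_bij_count_space[OF b, of f] by (simp add: nn_integral_count_space_nat)
  also have "\<dots> \<le> infsum f I"
  proof (rule suminf_le_const)
    fix n
    have "(\<Sum>k<n. f (?b k)) = sum f (?b ` {..<n})"
      using b by (subst sum.reindex) (auto simp: bij_betw_def intro: inj_on_subset)
    also have "\<dots> \<le> infsum f I"
      using b by (subst nonneg_infsum_complete) (auto simp: bij_betw_def intro!: SUP_upper)
    finally show "(\<Sum>k<n. f (?b k)) \<le> infsum f I" .
  qed simp
  finally show ?thesis .
qed

section \<open>The dual cell and linear changes of variables\<close>

lemma countable_dual_lattice: "countable (dual_lattice A)"
proof -
  have "\<exists>w :: int ^ 'a. v = (\<chi> i. of_int (w $ i))" if "int_vec v" for v :: "real ^ 'a"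
    using that by (intro exI[of _ "\<chi> i. \<lfloor>v $ i\<rfloor>"]) (auto simp: int_vec_def vec_eq_iff)
  then have "dual_lattice A \<subseteq> range (\<lambda>w :: int ^ 'a. matrix_inv (transpose A) *v (\<chi> i. of_int (w $ i)))"
    unfolding dual_lattice_def by fast
  then show ?thesis
    by (rule countable_subset) simp
qed

lemma mem_dual_cell:
  assumes "invertible A"
  shows "t \<in> dual_cell A \<longleftrightarrow> (\<forall>i. 0 \<le> (transpose A *v t) $ i \<and> (transpose A *v t) $ i \<le> 1)"
proof
  assume "t \<in> dual_cell A"
  then show "\<forall>i. 0 \<le> (transpose A *v t) $ i \<and> (transpose A *v t) $ i \<le> 1"
    by (auto simp: dual_cell_def matrix_inv_transpose[OF assms] simp del: transpose_matrix_vector)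
next
  assume "\<forall>i. 0 \<le> (transpose A *v t) $ i \<and> (transpose A *v t) $ i \<le> 1"
  then show "t \<in> dual_cell A"
    unfolding dual_cell_def
    by (intro CollectI exI[of _ "transpose A *v t"] conjI)
      (simp_all add: matrix_inv_transpose(2)[OF assms, of t] del: transpose_matrix_vector)
qed

lemma matrix_vector_mult_measurable [measurable]:
  fixes A :: "real ^ 'n ^ 'm"
  shows "(*v) A \<in> borel_measurable borel"
  by (intro borel_measurable_continuous_onI linear_continuous_on) (simp add: linear_linear)

lemma dual_cell_measurable:
  assumes "invertible A" shows "dual_cell A \<in> sets borel"
proof -
  have "dual_cell A = {t. \<forall>i. 0 \<le> (transpose A *v t) $ i \<and> (transpose A *v t) $ i \<le> 1}"
    using mem_dual_cell[OF assms] by auto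
  also have "\<dots> \<in> sets borel"
    by measurable
  finally show ?thesis .
qed

text \<open>Take integer parts of the coordinates \<open>transpose A *v t\<close>. Neighbouring
  closed cells share faces, so this is a covering and not a partition.\<close>

lemma dual_cell_cover:
  assumes "invertible A"
  obtains \<gamma> where "\<gamma> \<in> dual_lattice A" "t - \<gamma> \<in> dual_cell A"
proof
  define v where "v = transpose A *v t"
  define k :: "real ^ 'a" where "k = (\<chi> i. of_int \<lfloor>v $ i\<rfloor>)"
  show "matrix_inv (transpose A) *v k \<in> dual_lattice A"
    by (auto simp: dual_lattice_def int_vec_def k_def)
  have "transpose A *v (t - matrix_inv (transpose A) *v k) = v - k"
    by (simp only: matrix_vector_mult_diff_distrib matrix_inv_transpose(1)[OF assms] v_def)
  moreover have "0 \<le> v $ i - of_int \<lfloor>v $ i\<rfloor> \<and> v $ i - of_int \<lfloor>v $ i\<rfloor> \<le> 1" for i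
    by linarith
  ultimately show "t - matrix_inv (transpose A) *v k \<in> dual_cell A"
    unfolding mem_dual_cell[OF assms] by (simp add: k_def del: transpose_matrix_vector)
qed

lemma nn_integral_lborel_shift:
  fixes f :: "'a::euclidean_space \<Rightarrow> ennreal"
  assumes [measurable]: "f \<in> borel_measurable borel"
  shows "(\<integral>\<^sup>+t. f (t + a) \<partial>lborel) = (\<integral>\<^sup>+t. f t \<partial>lborel)"
  by (subst (2) lborel_distr_plus[of a, symmetric]) (simp add: nn_integral_distr add.commute)

text \<open>Uniqueness of translation-invariant measures, by averaging over the unit cube. This avoids the
  determinant formula of the library, which is restricted to well-ordered index types.\<close>

lemma nn_integral_matrix_image:
  fixes T :: "real ^ 'd ^ 'd"
  assumes "invertible T"
  obtains k :: real where "0 \<le> k"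
    "\<And>f. f \<in> borel_measurable borel \<Longrightarrow> (\<integral>\<^sup>+v. f (T *v v) \<partial>lborel) = ennreal k * (\<integral>\<^sup>+t. f t \<partial>lborel)"
proof -
  obtain T' where T': "T ** T' = mat 1" "T' ** T = mat 1"
    using assms by (auto simp: invertible_def)
  have TT': "T *v (T' *v v) = v" "T' *v (T *v v) = v" for v
    by (simp_all add: matrix_vector_mul_assoc T')
  define Q where "Q = cbox 0 (One :: real ^ 'd)"
  define h where "h = (indicator Q :: real ^ 'd \<Rightarrow> ennreal)"
  have [measurable]: "h \<in> borel_measurable borel"
    unfolding h_def Q_def by measurable
  have h1: "(\<integral>\<^sup>+y. h y \<partial>lborel) = 1"
    by (simp add: h_def Q_def emeasure_lborel_cbox_eq)
  define X where "X = {v. - (T *v v) \<in> Q}"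
  have [measurable]: "X \<in> sets borel"
    unfolding X_def Q_def by measurable
  have "X \<subseteq> (*v) T' ` uminus ` Q"
  proof
    fix v assume "v \<in> X"
    then have "T *v v \<in> uminus ` Q"
      by (intro image_eqI[of _ _ "- (T *v v)"]) (auto simp: X_def)
    then show "v \<in> (*v) T' ` uminus ` Q"
      by (intro image_eqI[of v "(*v) T'" "T *v v"]) (simp_all only: TT')
  qed
  moreover have "bounded ((*v) T' ` uminus ` Q)"
    by (intro bounded_linear_image matrix_vector_mul_bounded_linear bounded_linear_minus bounded_linear_ident)
      (simp add: Q_def)
  ultimately have "bounded X"
    by (rule bounded_subset[rotated])
  then have fin: "emeasure lborel X < \<infinity>"
    by (rule emeasure_bounded_finite)
  show thesis
  proof (rule that[of "measure lborel X"])
    fix f :: "real ^ 'd \<Rightarrow> ennreal" assume [measurable]: "f \<in> borel_measurable borel"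
    \<comment> \<open>Moving \<open>v\<close> by \<open>T' *v y\<close> absorbs \<open>y\<close>, so
      this mass is the same for every \<open>y\<close>; it becomes the constant
      \<open>k\<close>.\<close>
    have inner: "(\<integral>\<^sup>+v. h (y - T *v v) \<partial>lborel) = emeasure lborel X" for y
    proof -
      have "(\<integral>\<^sup>+v. h (y - T *v v) \<partial>lborel) = (\<integral>\<^sup>+v. h (y - T *v (v + T' *v y)) \<partial>lborel)"
        by (rule nn_integral_lborel_shift[symmetric]) measurable
      also have "\<dots> = (\<integral>\<^sup>+v. indicator X v \<partial>lborel)"
        by (intro nn_integral_cong) (simp add: matrix_vector_right_distrib TT' h_def X_def indicator_def)
      finally show ?thesis by simp
    qed
    have "(\<integral>\<^sup>+v. f (T *v v) \<partial>lborel) = (\<integral>\<^sup>+y. h y * (\<integral>\<^sup>+v. f (T *v v) \<partial>lborel) \<partial>lborel)"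
      by (simp add: nn_integral_multc h1)
    also have "\<dots> = (\<integral>\<^sup>+y. \<integral>\<^sup>+v. h y * f (y + T *v v) \<partial>lborel \<partial>lborel)"
    proof (rule nn_integral_cong)
      fix y
      have "(\<integral>\<^sup>+v. f (T *v v) \<partial>lborel) = (\<integral>\<^sup>+v. f (T *v (v + T' *v y)) \<partial>lborel)"
        by (rule nn_integral_lborel_shift[symmetric]) measurable
      then show "h y * (\<integral>\<^sup>+v. f (T *v v) \<partial>lborel) = (\<integral>\<^sup>+v. h y * f (y + T *v v) \<partial>lborel)"
        by (simp add: nn_integral_cmult matrix_vector_right_distrib TT' add.commute)
    qed
    also have "\<dots> = (\<integral>\<^sup>+v. \<integral>\<^sup>+y. h y * f (y + T *v v) \<partial>lborel \<partial>lborel)"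
      by (rule lborel_pair.Fubini') measurable
    also have "\<dots> = (\<integral>\<^sup>+v. \<integral>\<^sup>+y. h (y - T *v v) * f y \<partial>lborel \<partial>lborel)"
    proof (rule nn_integral_cong)
      fix v
      have "(\<integral>\<^sup>+y. h (y - T *v v) * f y \<partial>lborel) = (\<integral>\<^sup>+y. h (y + T *v v - T *v v) * f (y + T *v v) \<partial>lborel)"
        by (rule nn_integral_lborel_shift[symmetric]) measurable
      then show "(\<integral>\<^sup>+y. h y * f (y + T *v v) \<partial>lborel) = (\<integral>\<^sup>+y. h (y - T *v v) * f y \<partial>lborel)"
        by simp
    qed
    also have "\<dots> = (\<integral>\<^sup>+y. \<integral>\<^sup>+v. h (y - T *v v) * f y \<partial>lborel \<partial>lborel)"
      by (rule lborel_pair.Fubini') measurable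
    also have "\<dots> = emeasure lborel X * (\<integral>\<^sup>+y. f y \<partial>lborel)"
      by (simp add: nn_integral_multc inner nn_integral_cmult)
    finally show "(\<integral>\<^sup>+v. f (T *v v) \<partial>lborel) = ennreal (measure lborel X) * (\<integral>\<^sup>+t. f t \<partial>lborel)"
      using fin by (simp add: emeasure_eq_ennreal_measure)
  qed simp
qed

section \<open>Orthogonality of characters and the folded integral\<close>

lemma integral_unit_interval_cis:
  fixes k :: int
  shows "(LINT x|lborel. indicator {0..1} x *\<^sub>R cis (- (2 * pi * (x * of_int k)))) = (if k = 0 then 1 else 0)"
proof (cases "k = 0")
  case False
  define a where "a = - (2 * pi * of_int k)"
  have a: "a \<noteq> 0" using False by (simp add: a_def)
  have eq: "cis (- (2 * pi * (x * of_int k))) = exp (\<i> * of_real a * of_real x)" for x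
    by (simp add: cis_conv_exp a_def mult_ac)
  have "(LINT x|lborel. indicator {0..1} x *\<^sub>R exp (\<i> * of_real a * of_real x))
      = exp (\<i> * of_real a * of_real 1) / (\<i> * of_real a) - exp (\<i> * of_real a * of_real 0) / (\<i> * of_real a)"
  proof (rule integral_FTC_atLeastAtMost)
    fix x :: real
    have "((\<lambda>z. exp (\<i> * of_real a * z) / (\<i> * of_real a)) has_field_derivative exp (\<i> * of_real a * of_real x)) (at (of_real x))"
      using a by (auto intro!: derivative_eq_intros)
    from has_vector_derivative_real_field[OF this]
    show "((\<lambda>x. exp (\<i> * of_real a * of_real x) / (\<i> * of_real a)) has_vector_derivative exp (\<i> * of_real a * of_real x)) (at x within {0..1})" .
  qed (auto intro!: continuous_intros)
  also have "exp (\<i> * of_real a * of_real 1) = 1"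
    using exp_2pi_i_int[of "- of_int k"] by (simp add: a_def mult_ac)
  finally show ?thesis
    using False by (simp add: eq)
qed simp

lemma integral_unit_cube_cis:
  fixes j :: "real ^ 'd"
  assumes "int_vec j"
  shows "integrable lborel (\<lambda>v. indicator {v. \<forall>i. 0 \<le> v $ i \<and> v $ i \<le> 1} v *\<^sub>R cis (- (2 * pi * (v \<bullet> j))))"
    and "(LINT v|lborel. indicator {v. \<forall>i. 0 \<le> v $ i \<and> v $ i \<le> 1} v *\<^sub>R cis (- (2 * pi * (v \<bullet> j))))
      = (if j = 0 then 1 else 0)"
proof -
  obtain k where k: "j = (\<chi> i. of_int (k i))"
  proof
    show "j = (\<chi> i. of_int \<lfloor>j $ i\<rfloor>)"
      using assms by (auto simp: int_vec_def vec_eq_iff)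
  qed
  define f where "f i x = indicator {0..1} x *\<^sub>R cis (- (2 * pi * (x * of_int (k i))))" for i x
  have f: "integrable lborel (f i)" for i
  proof (rule Bochner_Integration.integrable_bound)
    show "integrable lborel (indicator {0..1} :: real \<Rightarrow> real)" by simp
    show "f i \<in> borel_measurable lborel"
      unfolding f_def[abs_def] by measurable
  qed (auto simp: f_def)
  have eq: "(\<Prod>i\<in>UNIV. f i (v $ i)) = indicator {v. \<forall>i. 0 \<le> v $ i \<and> v $ i \<le> 1} v *\<^sub>R cis (- (2 * pi * (v \<bullet> j)))"
    for v :: "real ^ 'd"
  proof -
    have "cis (- (2 * pi * (v \<bullet> j))) = (\<Prod>i\<in>UNIV. cis (- (2 * pi * (v $ i * of_int (k i)))))"
      by (simp add: k inner_vec_def cis_conv_exp sum_distrib_left flip: exp_sum sum_negf)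
    moreover have "indicator {v. \<forall>i. 0 \<le> v $ i \<and> v $ i \<le> 1} v = (\<Prod>i\<in>UNIV. indicator {0..1} (v $ i) :: real)"
      by (auto simp: indicator_def prod_eq_1_iff intro!: prod_zero[symmetric])
    ultimately show ?thesis
      by (simp add: f_def scaleR_conv_of_real prod.distrib)
  qed
  show "integrable lborel (\<lambda>v. indicator {v. \<forall>i. 0 \<le> v $ i \<and> v $ i \<le> 1} v *\<^sub>R cis (- (2 * pi * (v \<bullet> j))))"
    using lborel_integral_prod(1)[of f, OF f] by (simp add: eq)
  have "(LINT v|lborel. indicator {v. \<forall>i. 0 \<le> v $ i \<and> v $ i \<le> 1} v *\<^sub>R cis (- (2 * pi * (v \<bullet> j))))
      = (\<Prod>i\<in>UNIV. if k i = 0 then 1 else 0)"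
    using lborel_integral_prod(2)[of f, OF f] unfolding eq
    by (simp add: f_def integral_unit_interval_cis)
  also have "\<dots> = (if j = 0 then 1 else 0)"
    by (auto simp: k vec_eq_iff intro!: prod_zero)
  finally show "(LINT v|lborel. indicator {v. \<forall>i. 0 \<le> v $ i \<and> v $ i \<le> 1} v *\<^sub>R cis (- (2 * pi * (v \<bullet> j))))
      = (if j = 0 then 1 else 0)" .
qed

text \<open>Parseval's identity: in lattice coordinates the frequencies become integer vectors and
  the cell becomes the unit cube, where the characters are orthonormal. \<open>K\<close> is the
  volume of the dual cell, hence uniform in \<open>G\<close> and \<open>c\<close>.\<close>

lemma trig_poly_dual_cell:
  fixes A :: "real ^ 'd ^ 'd"
  assumes A: "invertible A"
  obtains K :: real where "0 \<le> K"
    "\<And>G c. finite G \<Longrightarrow> G \<subseteq> lattice A \<Longrightarrow>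
      (\<integral>\<^sup>+t. indicator (dual_cell A) t * ennreal ((cmod (trig_poly G c t))\<^sup>2) \<partial>lborel)
      = ennreal (K * (\<Sum>m\<in>G. (cmod (c m))\<^sup>2))"
proof -
  obtain K where K: "0 \<le> K" "\<And>f. f \<in> borel_measurable borel \<Longrightarrow>
      (\<integral>\<^sup>+v. f (transpose A *v v) \<partial>lborel) = ennreal K * (\<integral>\<^sup>+t. f t \<partial>lborel)"
    using nn_integral_matrix_image[OF transpose_invertible[OF A]] by blast
  show thesis
  proof (rule that[OF K(1)])
    fix G and c :: "'d rvec \<Rightarrow> complex" assume G: "finite G" "G \<subseteq> lattice A"
    define B where "B = matrix_inv (transpose A)"
    note AB = matrix_inv_transpose[OF A, folded B_def]
    have [measurable]: "dual_cell A \<in> sets borel"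
      by (rule dual_cell_measurable[OF A])
    define Q where "Q = {v :: real ^ 'd. \<forall>i. 0 \<le> v $ i \<and> v $ i \<le> 1}"
    have "\<forall>m\<in>G. \<exists>v. m = A *v v \<and> int_vec v"
      using G by (auto simp: lattice_def)
    then obtain k where k: "\<And>m. m \<in> G \<Longrightarrow> m = A *v k m" "\<And>m. m \<in> G \<Longrightarrow> int_vec (k m)"
      by metis
    \<comment> \<open>Distinct lattice points have distinct coordinate vectors because
      \<open>m = A *v k m\<close>. Off-diagonal terms therefore carry a nonzero integer frequency
      and integrate to 0.\<close>
    have kd: "int_vec (k m - k n)" "k m - k n = 0 \<longleftrightarrow> m = n" if "m \<in> G" "n \<in> G" for m n
      using k that by (auto simp: int_vec_def) metis
    have P: "trig_poly G c (B *v v) = (\<Sum>m\<in>G. c m * cis (- (2 * pi * (v \<bullet> k m))))" for v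
      unfolding trig_poly_def
    proof (rule sum.cong[OF refl])
      fix m assume "m \<in> G"
      have "(B *v v) \<bullet> m = (A *v k m) \<bullet> (B *v v)"
        using k(1)[OF \<open>m \<in> G\<close>] by (simp add: inner_commute)
      also have "\<dots> = v \<bullet> k m"
        by (simp only: inner_matrix_vector_transpose AB) (rule inner_commute)
      finally have "(B *v v) \<bullet> m = v \<bullet> k m" .
      then show "c m * cis (- (2 * pi * ((B *v v) \<bullet> m))) = c m * cis (- (2 * pi * (v \<bullet> k m)))"
        by simp
    qed
    have sq: "indicator Q v *\<^sub>R complex_of_real ((cmod (trig_poly G c (B *v v)))\<^sup>2)
        = (\<Sum>m\<in>G. \<Sum>n\<in>G. c m * cnj (c n) * (indicator Q v *\<^sub>R cis (- (2 * pi * (v \<bullet> (k m - k n))))))" for v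
      unfolding complex_norm_square P
      by (simp add: sum_product scaleR_sum_right cis_cnj mult_ac cis_mult algebra_simps)
    have int: "integrable lborel (\<lambda>v. c m * cnj (c n) * (indicator Q v *\<^sub>R cis (- (2 * pi * (v \<bullet> (k m - k n))))))"
      if "m \<in> G" "n \<in> G" for m n
      unfolding Q_def using that kd by (intro integrable_mult_right integral_unit_cube_cis)
    have i: "integrable lborel (\<lambda>v. indicator Q v *\<^sub>R complex_of_real ((cmod (trig_poly G c (B *v v)))\<^sup>2))"
      unfolding sq by (intro Bochner_Integration.integrable_sum int)
    have "(LINT v|lborel. indicator Q v *\<^sub>R complex_of_real ((cmod (trig_poly G c (B *v v)))\<^sup>2))
       = (\<Sum>m\<in>G. \<Sum>n\<in>G. c m * cnj (c n) * (if m = n then 1 else 0))"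
    proof -
      have *: "(LINT v|lborel. c m * cnj (c n) * (indicator Q v *\<^sub>R cis (- (2 * pi * (v \<bullet> (k m - k n))))))
          = c m * cnj (c n) * (if m = n then 1 else 0)" if "m \<in> G" "n \<in> G" for m n
        unfolding Q_def using kd[OF that] by (simp only: integral_mult_right_zero integral_unit_cube_cis(2) refl)
      show ?thesis
        unfolding sq
        by (subst Bochner_Integration.integral_sum, intro Bochner_Integration.integrable_sum int, assumption+,
            intro sum.cong[OF refl], subst Bochner_Integration.integral_sum, intro int, assumption+,
            intro sum.cong[OF refl] *)
    qed
    also have "\<dots> = of_real (\<Sum>m\<in>G. (cmod (c m))\<^sup>2)"
      using G(1) by (simp add: if_distrib complex_norm_square del: of_real_power cong: if_cong)
    also have "(LINT v|lborel. indicator Q v *\<^sub>R complex_of_real ((cmod (trig_poly G c (B *v v)))\<^sup>2))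
        = of_real (LINT v|lborel. indicator Q v *\<^sub>R (cmod (trig_poly G c (B *v v)))\<^sup>2)"
      by (simp flip: integral_complex_of_real add: scaleR_conv_of_real)
    finally have r: "(LINT v|lborel. indicator Q v *\<^sub>R (cmod (trig_poly G c (B *v v)))\<^sup>2) = (\<Sum>m\<in>G. (cmod (c m))\<^sup>2)"
      by (simp only: of_real_eq_iff)
    have "integrable lborel (\<lambda>v. indicator Q v *\<^sub>R (cmod (trig_poly G c (B *v v)))\<^sup>2)"
      using integrable_norm[OF i] by (simp add: norm_power)
    from nn_integral_eq_integral[OF this]
    have nn: "(\<integral>\<^sup>+v. ennreal (indicator Q v *\<^sub>R (cmod (trig_poly G c (B *v v)))\<^sup>2) \<partial>lborel) = ennreal (\<Sum>m\<in>G. (cmod (c m))\<^sup>2)"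
      by (simp add: r[simplified])
    have [measurable]: "Q \<in> sets borel"
      unfolding Q_def by measurable
    have "(\<integral>\<^sup>+t. indicator (dual_cell A) t * ennreal ((cmod (trig_poly G c t))\<^sup>2) \<partial>lborel)
       = (\<integral>\<^sup>+t. indicator Q (transpose A *v t) *
            ennreal ((cmod (trig_poly G c (B *v (transpose A *v t))))\<^sup>2) \<partial>lborel)"
      by (intro nn_integral_cong)
        (simp add: AB indicator_def Q_def mem_dual_cell[OF A] del: transpose_matrix_vector)
    also have "\<dots> = ennreal K * (\<integral>\<^sup>+v. indicator Q v * ennreal ((cmod (trig_poly G c (B *v v)))\<^sup>2) \<partial>lborel)"
      by (rule K(2)) measurable
    also have "(\<integral>\<^sup>+v. indicator Q v * ennreal ((cmod (trig_poly G c (B *v v)))\<^sup>2) \<partial>lborel)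
        = (\<integral>\<^sup>+v. ennreal (indicator Q v *\<^sub>R (cmod (trig_poly G c (B *v v)))\<^sup>2) \<partial>lborel)"
      by (intro nn_integral_cong) (simp add: indicator_def)
    finally show "(\<integral>\<^sup>+t. indicator (dual_cell A) t * ennreal ((cmod (trig_poly G c t))\<^sup>2) \<partial>lborel)
        = ennreal (K * (\<Sum>m\<in>G. (cmod (c m))\<^sup>2))"
      unfolding nn by (simp add: sum_nonneg ennreal_mult K(1))
  qed
qed

lemma trig_poly_periodic:
  assumes "invertible A" "G \<subseteq> lattice A" "\<gamma> \<in> dual_lattice A"
  shows "trig_poly G c (\<omega> + \<gamma>) = trig_poly G c \<omega>"
  unfolding trig_poly_def
proof (rule sum.cong[OF refl])
  fix m assume "m \<in> G"
  then have "- (\<gamma> \<bullet> m) \<in> \<int>"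
    using inner_lattice_dual_lattice[OF assms(1) _ assms(3), of m] assms(2) by (auto simp: inner_commute)
  from exp_2pi_i_int[OF this] have "cis (- (2 * pi * (\<gamma> \<bullet> m))) = 1"
    by (simp add: cis_conv_exp mult_ac)
  moreover have "cis (- (2 * pi * ((\<omega> + \<gamma>) \<bullet> m))) = cis (- (2 * pi * (\<omega> \<bullet> m))) * cis (- (2 * pi * (\<gamma> \<bullet> m)))"
    by (simp add: cis_mult inner_add_left algebra_simps)
  ultimately show "c m * cis (- (2 * pi * ((\<omega> + \<gamma>) \<bullet> m))) = c m * cis (- (2 * pi * (\<omega> \<bullet> m)))"
    by simp
qed

text \<open>The integral over the whole space is folded onto one cell. Periodicity of the
  trigonometric polynomial lets each shift act on \<open>H\<close> alone, and summing over the
  shifts produces the periodization.\<close>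

lemma nn_integral_trig_poly_le:
  fixes A :: "real ^ 'd ^ 'd"
  assumes A: "invertible A" and G: "G \<subseteq> lattice A"
    and [measurable]: "H \<in> borel_measurable borel"
    and bound: "AE t in lborel. t \<in> dual_cell A \<longrightarrow> periodization (dual_lattice A) H t \<le> ennreal C"
  shows "(\<integral>\<^sup>+t. ennreal ((cmod (trig_poly G c t * H t))\<^sup>2) \<partial>lborel)
    \<le> ennreal C * (\<integral>\<^sup>+t. indicator (dual_cell A) t * ennreal ((cmod (trig_poly G c t))\<^sup>2) \<partial>lborel)"
proof -
  have [measurable]: "dual_cell A \<in> sets borel"
    by (rule dual_cell_measurable[OF A])
  let ?L = "count_space (dual_lattice A)" and ?D = "dual_cell A" and ?P = "trig_poly G c"
  define f where "f t = ennreal ((cmod (?P t * H t))\<^sup>2)" for t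
  have [measurable]: "f \<in> borel_measurable borel" unfolding f_def by measurable
  \<comment> \<open>Some translated cell contains \<open>t\<close>, so the indicators add up to at
    least 1; points on common faces are counted repeatedly, which only enlarges the right
    side.\<close>
  have "(\<integral>\<^sup>+t. f t \<partial>lborel) \<le> (\<integral>\<^sup>+t. \<integral>\<^sup>+\<gamma>. indicator ?D (t - \<gamma>) * f t \<partial>?L \<partial>lborel)"
  proof (rule nn_integral_mono)
    fix t
    obtain \<gamma> where \<gamma>: "\<gamma> \<in> dual_lattice A" "t - \<gamma> \<in> ?D"
      by (rule dual_cell_cover[OF A])
    then have "f t = indicator ?D (t - \<gamma>) * f t" by simp
    also have "\<dots> \<le> (\<integral>\<^sup>+\<gamma>. indicator ?D (t - \<gamma>) * f t \<partial>?L)"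
      using \<gamma>(1) by (rule nn_integral_ge_point)
    finally show "f t \<le> (\<integral>\<^sup>+\<gamma>. indicator ?D (t - \<gamma>) * f t \<partial>?L)" .
  qed
  also have "\<dots> = (\<integral>\<^sup>+\<gamma>. \<integral>\<^sup>+t. indicator ?D (t - \<gamma>) * f t \<partial>lborel \<partial>?L)"
    by (intro nn_integral_count_space_nn_integral countable_dual_lattice) measurable
  also have "\<dots> = (\<integral>\<^sup>+\<gamma>. \<integral>\<^sup>+t. indicator ?D t * ennreal ((cmod (?P t))\<^sup>2) * ennreal ((cmod (H (t + \<gamma>)))\<^sup>2) \<partial>lborel \<partial>?L)"
  proof (rule nn_integral_cong)
    fix \<gamma> assume "\<gamma> \<in> space ?L"
    then have \<gamma>: "\<gamma> \<in> dual_lattice A" by simp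
    have "(\<integral>\<^sup>+t. indicator ?D (t - \<gamma>) * f t \<partial>lborel) = (\<integral>\<^sup>+t. indicator ?D (t + \<gamma> - \<gamma>) * f (t + \<gamma>) \<partial>lborel)"
      by (rule nn_integral_lborel_shift[symmetric]) measurable
    also have "\<dots> = (\<integral>\<^sup>+t. indicator ?D t * ennreal ((cmod (?P t))\<^sup>2) * ennreal ((cmod (H (t + \<gamma>)))\<^sup>2) \<partial>lborel)"
      by (simp add: f_def trig_poly_periodic[OF A G \<gamma>] norm_mult power_mult_distrib ennreal_mult mult.assoc)
    finally show "(\<integral>\<^sup>+t. indicator ?D (t - \<gamma>) * f t \<partial>lborel)
        = (\<integral>\<^sup>+t. indicator ?D t * ennreal ((cmod (?P t))\<^sup>2) * ennreal ((cmod (H (t + \<gamma>)))\<^sup>2) \<partial>lborel)" .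
  qed
  also have "\<dots> = (\<integral>\<^sup>+t. \<integral>\<^sup>+\<gamma>. indicator ?D t * ennreal ((cmod (?P t))\<^sup>2) * ennreal ((cmod (H (t + \<gamma>)))\<^sup>2) \<partial>?L \<partial>lborel)"
    by (intro nn_integral_count_space_nn_integral[symmetric] countable_dual_lattice) measurable
  also have "\<dots> = (\<integral>\<^sup>+t. indicator ?D t * ennreal ((cmod (?P t))\<^sup>2) * (\<integral>\<^sup>+\<gamma>. ennreal ((cmod (H (t + \<gamma>)))\<^sup>2) \<partial>?L) \<partial>lborel)"
    by (simp add: nn_integral_cmult)
  also have "\<dots> \<le> (\<integral>\<^sup>+t. indicator ?D t * ennreal ((cmod (?P t))\<^sup>2) * ennreal C \<partial>lborel)"
  proof (rule nn_integral_mono_AE, use bound in eventually_elim)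
    case (elim t)
    show ?case
    proof (cases "t \<in> ?D")
      case True
      have "(\<integral>\<^sup>+\<gamma>. ennreal ((cmod (H (t + \<gamma>)))\<^sup>2) \<partial>?L) \<le> ennreal C"
        using nn_integral_count_space_le_infsum[OF countable_dual_lattice] elim True
        unfolding periodization_def by (blast intro: order_trans)
      then show ?thesis by (rule mult_left_mono) simp
    qed simp
  qed
  also have "\<dots> = ennreal C * (\<integral>\<^sup>+t. indicator ?D t * ennreal ((cmod (?P t))\<^sup>2) \<partial>lborel)"
    by (subst nn_integral_multc) (auto simp: mult.commute)
  finally show ?thesis
    by (simp add: f_def)
qed

lemma Bessel_translates:
  fixes A :: "real ^ 'd ^ 'd"
  assumes A: "invertible A" and \<psi>: "L2 \<psi>" "is_L2_fourier \<psi> H"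
    and bound: "AE t in lborel. t \<in> dual_cell A \<longrightarrow> periodization (dual_lattice A) H t \<le> ennreal C"
  obtains K where "0 \<le> K" "\<And>G c. finite G \<Longrightarrow> G \<subseteq> lattice A \<Longrightarrow>
    (l2norm (\<lambda>t. \<Sum>m\<in>G. c m * transl m \<psi> t))\<^sup>2 \<le> K * (\<Sum>m\<in>G. (cmod (c m))\<^sup>2)"
proof -
  obtain K where K: "0 \<le> K" "\<And>G c. finite G \<Longrightarrow> G \<subseteq> lattice A \<Longrightarrow>
      (\<integral>\<^sup>+t. indicator (dual_cell A) t * ennreal ((cmod (trig_poly G c t))\<^sup>2) \<partial>lborel)
      = ennreal (K * (\<Sum>m\<in>G. (cmod (c m))\<^sup>2))"
    using trig_poly_dual_cell[OF A] by blast
  \<comment> \<open>\<open>C\<close> may be negative, in which case \<open>ennreal C\<close> is 0;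
    \<open>max 0 C\<close> is the nonnegative real with the same image.\<close>
  show thesis
  proof (rule that[of "max 0 C * K"])
    fix G and c :: "'d rvec \<Rightarrow> complex" assume G: "finite G" "G \<subseteq> lattice A"
    have H: "L2 H" using \<psi>(2) by (simp add: is_L2_fourier_def)
    have PH: "L2 (\<lambda>\<omega>. trig_poly G c \<omega> * H \<omega>)"
      by (rule L2_bounded_mult[OF H _ norm_trig_poly_le]) measurable
    have "ennreal ((l2norm (\<lambda>t. \<Sum>m\<in>G. c m * transl m \<psi> t))\<^sup>2) \<le> ennreal ((l2norm (\<lambda>\<omega>. trig_poly G c \<omega> * H \<omega>))\<^sup>2)"
      by (intro ennreal_leI power_mono l2norm_translates_le \<psi>) simp
    also have "\<dots> \<le> ennreal C * ennreal (K * (\<Sum>m\<in>G. (cmod (c m))\<^sup>2))"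
      unfolding l2norm_square_nn[OF PH] K(2)[OF G, symmetric]
      by (rule nn_integral_trig_poly_le[OF A G(2) L2_measurable[OF H] bound])
    also have "\<dots> = ennreal (max 0 C * K * (\<Sum>m\<in>G. (cmod (c m))\<^sup>2))"
      using K(1) by (cases "C \<ge> 0") (simp_all add: sum_nonneg ennreal_mult mult.assoc ennreal_neg max_def)
    finally show "(l2norm (\<lambda>t. \<Sum>m\<in>G. c m * transl m \<psi> t))\<^sup>2 \<le> max 0 C * K * (\<Sum>m\<in>G. (cmod (c m))\<^sup>2)"
      using K(1) by (simp add: sum_nonneg)
  qed (simp add: K(1))
qed

section \<open>Phase retrieval from the lattice\<close>

lemma AE_lborel_shift:
  fixes a :: "'a::euclidean_space"
  assumes "AE t in lborel. P t" and [measurable]: "Measurable.pred borel P"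
  shows "AE t in lborel. P (t - a)"
proof -
  have "AE t in distr lborel borel ((+) (- a)). P t"
    using assms(1) by (simp only: lborel_distr_plus)
  then show ?thesis
    by (subst (asm) AE_distr_iff) auto
qed

lemma tfshift_cong_AE:
  assumes "L2 f" "L2 h" "AE t in lborel. f t = h t"
  shows "AE t in lborel. tfshift z f t = tfshift z h t"
proof -
  note [measurable] = assms(1,2)[THEN L2_measurable]
  have "AE t in lborel. f (t - pos z) = h (t - pos z)"
    by (rule AE_lborel_shift[OF assms(3)]) measurable
  then show ?thesis
    by eventually_elim (simp add: tfshift_def)
qed

lemma pos_pair_vec [simp]: "pos (pair_vec x \<omega>) = x"
  and freq_pair_vec [simp]: "freq (pair_vec x \<omega>) = \<omega>"
  by (simp_all add: pos_def freq_def pair_vec_def)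

lemma tfshift_pair_vec_0: "tfshift (pair_vec m 0) h = transl m h"
  by (simp add: tfshift_def transl_def)

text \<open>By covariance the conjugated translation is a plain time-frequency shift, so the operator
  \<open>\<mu>(S)\<close> disappears from the phase retrieval identity.\<close>

lemma transl_S_AE:
  assumes mu: "metaplectic_pair S U V" and h: "L2 h"
  shows "L2 (transl_S U V m h)"
    and "AE t in lborel. transl_S U V m h t = tfshift (S *v pair_vec m 0) h t"
proof -
  have un: "unitary_pair U V"
    and cov: "\<And>z f. L2 f \<Longrightarrow> AE t in lborel. U (tfshift z f) t = tfshift (S *v z) (U f) t"
    using mu by (auto simp: metaplectic_pair_def)
  have L2V: "L2 (V h)" and L2U: "\<And>f. L2 f \<Longrightarrow> L2 (U f)" and UV: "AE t in lborel. U (V h) t = h t"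
    using un h by (auto simp: unitary_pair_def)
  show "L2 (transl_S U V m h)"
    unfolding transl_S_def by (intro L2U L2_transl L2V)
  have "AE t in lborel. U (transl m (V h)) t = tfshift (S *v pair_vec m 0) (U (V h)) t"
    using cov[OF L2V, of "pair_vec m 0"] by (simp add: tfshift_pair_vec_0)
  moreover have "AE t in lborel. tfshift (S *v pair_vec m 0) (U (V h)) t = tfshift (S *v pair_vec m 0) h t"
    by (intro tfshift_cong_AE L2U L2V h UV)
  ultimately show "AE t in lborel. transl_S U V m h t = tfshift (S *v pair_vec m 0) h t"
    unfolding transl_S_def by eventually_elim simp
qed

lemma cmod_stft_finite_sum:
  fixes g :: "'d::finite sig"
  assumes g: "L2 g" and A: "invertible A" and S: "symplectic S" and mu: "metaplectic_pair S U V"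
    and G: "G \<subseteq> lattice A" and l: "l \<in> dual_lattice A"
  shows "cmod (stft g (\<lambda>t. \<Sum>m\<in>G. c m * transl_S U V m (reflect g) t) (S *v pair_vec x l))
    = cmod (stft g (\<lambda>t. \<Sum>m\<in>G. cnj (c m) * transl_S U V m (reflect g) t) (S *v pair_vec x l))"
proof -
  define z where "z = S *v pair_vec x l"
  define \<theta> where "\<theta> = exp (- (2 * of_real pi * \<i> * of_real (pos z \<bullet> freq z)))"
  define a where "a m = stft g (transl_S U V m (reflect g)) z" for m
  note T = transl_S_AE[OF mu L2_reflect[OF g]]
  have \<theta>: "cmod \<theta> = 1"
    unfolding \<theta>_def by (rule cmod_exp_imaginary)
  have a: "a m = \<theta> * cnj (a m)" if "m \<in> G" for m
  proof -
    define u where "u = S *v pair_vec m 0"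
    have "a m = stft g (tfshift u (reflect g)) z"
      unfolding a_def u_def by (rule stft_cong_AE[OF g T(1) L2_tfshift[OF L2_reflect[OF g]] T(2)])
    \<comment> \<open>The vector \<open>pair_vec m 0\<close> has no frequency part, so
      \<open>x\<close> drops out of the form. This is why the first component of the sampling set
      ranges over all of space.\<close>
    moreover have "freq u \<bullet> pos z - pos u \<bullet> freq z = - (m \<bullet> l)"
      unfolding u_def z_def by (subst symplectic_form_invariant[OF S]) simp
    moreover have "- (m \<bullet> l) \<in> \<int>"
      using inner_lattice_dual_lattice[OF A _ l] G that by auto
    ultimately show ?thesis
      using stft_tfshift_reflect[OF g, of u z] exp_2pi_i_int[of "- (m \<bullet> l)"] by (simp add: \<theta>_def)
  qed
  have "cmod (\<Sum>m\<in>G. c m * a m) = cmod (cnj (\<Sum>m\<in>G. c m * a m))"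
    by (rule complex_mod_cnj[symmetric])
  \<comment> \<open>The unimodular factor turns every \<open>cnj (a m)\<close> back into
    \<open>a m\<close>, while the coefficients stay conjugated.\<close>
  also have "\<dots> = cmod (\<theta> * (\<Sum>m\<in>G. cnj (c m) * cnj (a m)))"
    by (simp add: norm_mult \<theta>)
  also have "\<theta> * (\<Sum>m\<in>G. cnj (c m) * cnj (a m)) = (\<Sum>m\<in>G. cnj (c m) * a m)"
    unfolding sum_distrib_left using a by (intro sum.cong refl) (metis mult.left_commute)
  finally show ?thesis
    unfolding z_def[symmetric] by (simp only: stft_sum[OF g T(1)] a_def)
qed

section \<open>Unconditional convergence of the series\<close>

lemma unitary_pair_sum:
  assumes un: "unitary_pair U V" and G: "finite G" and F: "\<And>i. L2 (F i)"
  shows "AE t in lborel. U (\<lambda>s. \<Sum>i\<in>G. c i * F i s) t = (\<Sum>i\<in>G. c i * U (F i) t)"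
proof -
  have lin: "AE t in lborel. U (\<lambda>s. f s + a * h s) t = U f t + a * U h t" if "L2 f" "L2 h" for f h a
    using un that unfolding unitary_pair_def by simp
  show ?thesis
    using G
  proof (induction G)
    case empty
    \<comment> \<open>Linearity is available for combinations \<open>f + a * h\<close>, so the value
      of \<open>U\<close> at zero is read off from \<open>U 0 = U 0 + U 0\<close>.\<close>
    have "AE t in lborel. U (\<lambda>s. 0 + 1 * 0) t = U (\<lambda>s. 0) t + 1 * U (\<lambda>s. 0) t"
      by (rule lin) simp_all
    then show ?case by simp
  next
    case (insert i G)
    have "AE t in lborel. U (\<lambda>s. (\<Sum>i\<in>G. c i * F i s) + c i * F i s) t
        = U (\<lambda>s. \<Sum>i\<in>G. c i * F i s) t + c i * U (F i) t"
      by (intro lin L2_sum L2_cmult F)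
    with insert.IH show ?case
      by eventually_elim (simp add: insert.hyps add.commute)
  qed
qed

lemma unitary_pair_l2norm:
  assumes "unitary_pair U V" "L2 f"
  shows "l2norm (U f) = l2norm f"
  using assms by (auto simp: unitary_pair_def l2dist_eq_l2norm)

text \<open>Beyond a large finite set the square sum of \<open>c\<close> is small, so by the Bessel
  bound every finite sum over indices outside that set is small in norm. This Cauchy condition
  refers to no enumeration and hence gives convergence along all finite subsets.\<close>

lemma L2_has_sum_Bessel:
  fixes F :: "'i \<Rightarrow> 'd::finite sig"
  assumes F: "\<And>i. L2 (F i)"
    and K: "0 \<le> K" "\<And>G. finite G \<Longrightarrow> G \<subseteq> I \<Longrightarrow> (l2norm (\<lambda>t. \<Sum>i\<in>G. c i * F i t))\<^sup>2 \<le> K * (\<Sum>i\<in>G. (cmod (c i))\<^sup>2)"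
    and c: "(\<lambda>i. (cmod (c i))\<^sup>2) summable_on I"
  shows "\<exists>f. L2_has_sum (\<lambda>i t. c i * F i t) I f"
proof -
  define T where "T G t = (\<Sum>i\<in>G. c i * F i t)" for G t
  have L2T: "L2 (T G)" for G
    unfolding T_def[abs_def] by (intro L2_sum L2_cmult F)
  have "\<exists>X. finite X \<and> X \<subseteq> I \<and> (\<forall>Y. finite Y \<longrightarrow> Y \<subseteq> I \<longrightarrow> X \<inter> Y = {} \<longrightarrow> l2norm (T Y) \<le> (1/2)^n)" for n
  proof -
    define s where "s = infsum (\<lambda>i. (cmod (c i))\<^sup>2) I"
    \<comment> \<open>\<open>(1/4)^n\<close> is the square of the target bound
      \<open>(1/2)^n\<close>; dividing by \<open>K + 1\<close> covers the case
      \<open>K = 0\<close>.\<close>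
    define d where "d = (1/4)^n / (K + 1)"
    have "0 < d" using K(1) by (simp add: d_def)
    have "((\<lambda>i. (cmod (c i))\<^sup>2) has_sum s) I"
      unfolding s_def using c by (rule has_sum_infsum)
    then have "\<forall>\<^sub>F X in finite_subsets_at_top I. dist (\<Sum>i\<in>X. (cmod (c i))\<^sup>2) s < d / 2"
      using half_gt_zero[OF \<open>0 < d\<close>] unfolding has_sum_def tendsto_iff by blast
    then obtain X where X: "finite X" "X \<subseteq> I"
        and "\<forall>Y. finite Y \<and> X \<subseteq> Y \<and> Y \<subseteq> I \<longrightarrow> dist (\<Sum>i\<in>Y. (cmod (c i))\<^sup>2) s < d / 2"
      unfolding eventually_finite_subsets_at_top by (elim exE conjE)
    then have near: "dist (\<Sum>i\<in>Y. (cmod (c i))\<^sup>2) s < d / 2" if "finite Y" "X \<subseteq> Y" "Y \<subseteq> I" for Y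
      using that by simp
    have "l2norm (T Y) \<le> (1/2)^n" if Y: "finite Y" "Y \<subseteq> I" "X \<inter> Y = {}" for Y
    proof (rule power2_le_imp_le)
      have "(\<Sum>i\<in>Y. (cmod (c i))\<^sup>2) = (\<Sum>i\<in>X \<union> Y. (cmod (c i))\<^sup>2) - (\<Sum>i\<in>X. (cmod (c i))\<^sup>2)"
        using X Y by (subst sum.union_disjoint) auto
      also have "\<dots> \<le> d"
        using near[OF X(1) order_refl X(2)] near[of "X \<union> Y"] X Y
        unfolding dist_real_def by (simp add: abs_if split: if_splits)
      finally have d: "(\<Sum>i\<in>Y. (cmod (c i))\<^sup>2) \<le> d" .
      have "(l2norm (T Y))\<^sup>2 \<le> K * (\<Sum>i\<in>Y. (cmod (c i))\<^sup>2)"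
        unfolding T_def[abs_def] by (rule K(2)[OF Y(1,2)])
      also have "\<dots> \<le> K * d"
        by (rule mult_left_mono[OF d K(1)])
      also have "\<dots> \<le> (K + 1) * d"
        using \<open>0 < d\<close> by (simp add: mult_right_mono)
      also have "\<dots> = (1/4)^n"
        using K(1) by (simp add: d_def)
      also have "(1/4 :: real)^n = ((1/2)^n)\<^sup>2"
        by (simp add: power2_eq_square flip: power_mult_distrib)
      finally show "(l2norm (T Y))\<^sup>2 \<le> ((1/2)^n)\<^sup>2" .
    qed simp
    with X show ?thesis by blast
  qed
  then obtain X where X: "\<And>n. finite (X n)" "\<And>n. X n \<subseteq> I"
      and small: "\<And>n Y. finite Y \<Longrightarrow> Y \<subseteq> I \<Longrightarrow> X n \<inter> Y = {} \<Longrightarrow> l2norm (T Y) \<le> (1/2)^n"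
    by metis
  \<comment> \<open>Unions make the sets increase, so consecutive partial sums differ by a sum over
    indices outside \<open>X n\<close>.\<close>
  define Z where "Z n = (\<Union>k\<le>n. X k)" for n
  have Z: "finite (Z n)" "Z n \<subseteq> I" "X n \<subseteq> Z n" "Z n \<subseteq> Z (Suc n)" for n
    using X by (auto simp: Z_def atMost_Suc)
  have tail: "l2norm (\<lambda>t. T Y t - T (Z n) t) \<le> (1/2)^n" if "finite Y" "Y \<subseteq> I" "Z n \<subseteq> Y" for Y n
  proof -
    have "(\<lambda>t. T Y t - T (Z n) t) = T (Y - Z n)"
      using that by (simp add: T_def fun_eq_iff sum_diff)
    moreover have "l2norm (T (Y - Z n)) \<le> (1/2)^n"
      using that Z(3)[of n] by (intro small) auto
    ultimately show ?thesis by simp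
  qed
  have "l2norm (\<lambda>t. T (Z (Suc n)) t - T (Z n) t) \<le> (1/2)^n" for n
    by (intro tail Z)
  then obtain f where f: "L2 f" "\<And>n. l2norm (\<lambda>t. f t - T (Z n) t) \<le> 2 * (1/2)^n"
    by (rule L2_complete[where F = "\<lambda>n. T (Z n)", OF L2T]) blast
  have "\<exists>F0. finite F0 \<and> F0 \<subseteq> I \<and> (\<forall>G. finite G \<and> F0 \<subseteq> G \<and> G \<subseteq> I \<longrightarrow> l2dist f (T G) < e)" if "0 < e" for e
  proof -
    \<comment> \<open>The error is at most \<open>2 * (1/2)^n\<close> from the limit
      \<open>f\<close> plus \<open>(1/2)^n\<close> from the tail, hence the divisor 3.\<close>
    obtain n where n: "(1/2 :: real)^n < e / 3"
      using real_arch_pow_inv[of "e/3" "1/2"] \<open>0 < e\<close> by auto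
    have "l2dist f (T G) < e" if "finite G" "Z n \<subseteq> G" "G \<subseteq> I" for G
    proof -
      have "l2dist f (T G) \<le> l2norm (\<lambda>t. f t - T (Z n) t) + l2norm (\<lambda>t. T (Z n) t - T G t)"
        unfolding l2dist_eq_l2norm by (intro l2norm_diff_triangle f L2T)
      then show ?thesis
        using f(2)[of n] tail[OF that(1,3,2)] n by (simp add: l2norm_diff_commute[of "T (Z n)"])
    qed
    then show ?thesis
      using Z(1,2)[of n] by (intro exI[of _ "Z n"]) simp
  qed
  with f(1) show ?thesis
    unfolding L2_has_sum_def T_def[abs_def] by (intro exI[of _ f]) simp
qed

text \<open>The sums are determined only up to null sets, so their existence is claimed separately
  and the equality for every choice of representatives.\<close>

theorem theorem3p1:
  fixes g :: "'d::finite sig"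
    and A :: "real ^ 'd ^ 'd"
    and S :: "real ^ ('d + 'd) ^ ('d + 'd)"
    and U V :: "'d sig \<Rightarrow> 'd sig"
    and c :: "'d rvec \<Rightarrow> complex"
  assumes g: "L2 g"
    and A: "invertible A"
    and S: "symplectic S"
    and mu: "metaplectic_pair S U V"
  shows
    "(finite {m\<in>lattice A. c m \<noteq> 0} \<longrightarrow>
       (\<forall>x l. l \<in> dual_lattice A \<longrightarrow>
          cmod (stft g (\<lambda>t. \<Sum>m\<in>{m\<in>lattice A. c m \<noteq> 0}.
                              c m * transl_S U V m (reflect g) t) (S *v pair_vec x l))
        = cmod (stft g (\<lambda>t. \<Sum>m\<in>{m\<in>lattice A. c m \<noteq> 0}.
                              cnj (c m) * transl_S U V m (reflect g) t) (S *v pair_vec x l))))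
     \<and>
     ((\<exists>H C. is_L2_fourier (V (reflect g)) H \<and>
             (AE t in lborel. t \<in> dual_cell A \<longrightarrow>
                 periodization (dual_lattice A) H t \<le> ennreal C))
      \<and> (\<lambda>m. (cmod (c m))^2) summable_on lattice A
      \<longrightarrow>
       (\<exists>f. L2_has_sum (\<lambda>m. \<lambda>t. c m * transl_S U V m (reflect g) t) (lattice A) f) \<and>
       (\<exists>fx. L2_has_sum (\<lambda>m. \<lambda>t. cnj (c m) * transl_S U V m (reflect g) t) (lattice A) fx) \<and>
       (\<forall>f fx. L2_has_sum (\<lambda>m. \<lambda>t. c m * transl_S U V m (reflect g) t) (lattice A) f \<longrightarrow>
               L2_has_sum (\<lambda>m. \<lambda>t. cnj (c m) * transl_S U V m (reflect g) t) (lattice A) fx \<longrightarrow>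
          (\<forall>x l. l \<in> dual_lattice A \<longrightarrow>
             cmod (stft g f (S *v pair_vec x l)) = cmod (stft g fx (S *v pair_vec x l)))))"
proof (intro conjI impI allI)
  let ?T = "\<lambda>m. transl_S U V m (reflect g)"
  fix x l :: "'d rvec" assume "l \<in> dual_lattice A"
  then show "cmod (stft g (\<lambda>t. \<Sum>m\<in>{m\<in>lattice A. c m \<noteq> 0}. c m * ?T m t) (S *v pair_vec x l))
      = cmod (stft g (\<lambda>t. \<Sum>m\<in>{m\<in>lattice A. c m \<noteq> 0}. cnj (c m) * ?T m t) (S *v pair_vec x l))"
    by (intro cmod_stft_finite_sum[OF g A S mu]) auto
next
  let ?T = "\<lambda>m. transl_S U V m (reflect g)"
  note T = transl_S_AE(1)[OF mu L2_reflect[OF g]]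
  assume hyp: "(\<exists>H C. is_L2_fourier (V (reflect g)) H \<and>
      (AE t in lborel. t \<in> dual_cell A \<longrightarrow> periodization (dual_lattice A) H t \<le> ennreal C))
    \<and> (\<lambda>m. (cmod (c m))^2) summable_on lattice A"
  have un: "unitary_pair U V" using mu by (simp add: metaplectic_pair_def)
  define \<psi> where "\<psi> = V (reflect g)"
  have \<psi>: "L2 \<psi>"
    using un L2_reflect[OF g] by (auto simp: unitary_pair_def \<psi>_def)
  obtain H C where HC: "is_L2_fourier \<psi> H"
      "AE t in lborel. t \<in> dual_cell A \<longrightarrow> periodization (dual_lattice A) H t \<le> ennreal C"
    using hyp by (auto simp: \<psi>_def)
  obtain K where K: "0 \<le> K" "\<And>G b. finite G \<Longrightarrow> G \<subseteq> lattice A \<Longrightarrow>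
      (l2norm (\<lambda>t. \<Sum>m\<in>G. b m * transl m \<psi> t))\<^sup>2 \<le> K * (\<Sum>m\<in>G. (cmod (b m))\<^sup>2)"
    by (fact Bessel_translates[OF A \<psi> HC])
  \<comment> \<open>\<open>U\<close> is isometric and linear up to null sets, so the bound for
    translates of \<open>\<psi>\<close> passes to the conjugated translations with the same
    constant. Since \<open>b\<close> is arbitrary, it applies to \<open>c\<close> and to its
    conjugate.\<close>
  have Bessel: "(l2norm (\<lambda>t. \<Sum>m\<in>G. b m * ?T m t))\<^sup>2 \<le> K * (\<Sum>m\<in>G. (cmod (b m))\<^sup>2)"
    if G: "finite G" "G \<subseteq> lattice A" for G b
  proof -
    have L: "L2 (\<lambda>s. \<Sum>m\<in>G. b m * transl m \<psi> s)"
      by (intro L2_sum L2_cmult L2_transl \<psi>)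
    have AE: "AE t in lborel. U (\<lambda>s. \<Sum>m\<in>G. b m * transl m \<psi> s) t = (\<Sum>m\<in>G. b m * ?T m t)"
      unfolding transl_S_def \<psi>_def[symmetric] by (intro unitary_pair_sum[OF un G(1)] L2_transl \<psi>)
    have LU: "L2 (U (\<lambda>s. \<Sum>m\<in>G. b m * transl m \<psi> s))"
      using un L by (auto simp: unitary_pair_def)
    have LT: "L2 (\<lambda>t. \<Sum>m\<in>G. b m * ?T m t)"
      by (intro L2_sum L2_cmult T)
    have "l2norm (\<lambda>t. \<Sum>m\<in>G. b m * ?T m t) = l2norm (\<lambda>t. \<Sum>m\<in>G. b m * transl m \<psi> t)"
      using l2norm_cong_AE[OF LU LT AE] unitary_pair_l2norm[OF un L] by simp
    then show ?thesis using K(2)[OF G] by simp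
  qed
  show "\<exists>f. L2_has_sum (\<lambda>m. \<lambda>t. c m * ?T m t) (lattice A) f"
    using hyp by (intro L2_has_sum_Bessel[OF T K(1) Bessel]) auto
  show "\<exists>fx. L2_has_sum (\<lambda>m. \<lambda>t. cnj (c m) * ?T m t) (lattice A) fx"
    using hyp by (intro L2_has_sum_Bessel[OF T K(1) Bessel]) auto
next
  let ?T = "\<lambda>m. transl_S U V m (reflect g)"
  note T = transl_S_AE(1)[OF mu L2_reflect[OF g]]
  fix f fx and x l :: "'d rvec"
  assume f: "L2_has_sum (\<lambda>m. \<lambda>t. c m * ?T m t) (lattice A) f"
    and fx: "L2_has_sum (\<lambda>m. \<lambda>t. cnj (c m) * ?T m t) (lattice A) fx"
    and l: "l \<in> dual_lattice A"
  define z where "z = S *v pair_vec x l"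
  define M where "M = l2norm (stft_kernel g z)"
  have "0 \<le> M" by (simp add: M_def)
  have "\<bar>cmod (stft g f z) - cmod (stft g fx z)\<bar> \<le> 0 + e" if "0 < e" for e
  proof -
    \<comment> \<open>Each of the two sums contributes an error of at most \<open>d * M\<close>;
      using \<open>M + 1\<close> keeps the denominator positive.\<close>
    define d where "d = e / (2 * (M + 1))"
    have "0 < d" using that \<open>0 \<le> M\<close> by (simp add: d_def)
    obtain F1 where F1: "finite F1" "F1 \<subseteq> lattice A" "\<And>G. finite G \<Longrightarrow> F1 \<subseteq> G \<Longrightarrow> G \<subseteq> lattice A \<Longrightarrow>
        l2dist f (\<lambda>t. \<Sum>m\<in>G. c m * ?T m t) < d"
      using f[unfolded L2_has_sum_def, THEN conjunct2, rule_format, OF \<open>0 < d\<close>] by auto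
    obtain F2 where F2: "finite F2" "F2 \<subseteq> lattice A" "\<And>G. finite G \<Longrightarrow> F2 \<subseteq> G \<Longrightarrow> G \<subseteq> lattice A \<Longrightarrow>
        l2dist fx (\<lambda>t. \<Sum>m\<in>G. cnj (c m) * ?T m t) < d"
      using fx[unfolded L2_has_sum_def, THEN conjunct2, rule_format, OF \<open>0 < d\<close>] by auto
    \<comment> \<open>One finite set has to approximate both sums, because the finite identity
      compares moduli over the same index set.\<close>
    define G where "G = F1 \<union> F2"
    have G: "finite G" "G \<subseteq> lattice A" "F1 \<subseteq> G" "F2 \<subseteq> G"
      using F1 F2 by (auto simp: G_def)
    have L: "L2 (\<lambda>t. \<Sum>m\<in>G. b m * ?T m t)" for b
      by (intro L2_sum L2_cmult T)
    have "cmod (stft g f z - stft g (\<lambda>t. \<Sum>m\<in>G. c m * ?T m t) z) \<le> d * M"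
      unfolding M_def using F1(3)[OF G(1,3,2)] f
      by (intro order_trans[OF stft_diff_le[OF g _ L]] mult_right_mono) (auto simp: L2_has_sum_def)
    moreover have "cmod (stft g fx z - stft g (\<lambda>t. \<Sum>m\<in>G. cnj (c m) * ?T m t) z) \<le> d * M"
      unfolding M_def using F2(3)[OF G(1,4,2)] fx
      by (intro order_trans[OF stft_diff_le[OF g _ L]] mult_right_mono) (auto simp: L2_has_sum_def)
    moreover have "cmod (stft g (\<lambda>t. \<Sum>m\<in>G. c m * ?T m t) z) = cmod (stft g (\<lambda>t. \<Sum>m\<in>G. cnj (c m) * ?T m t) z)"
      unfolding z_def by (rule cmod_stft_finite_sum[OF g A S mu G(2) l])
    ultimately have "\<bar>cmod (stft g f z) - cmod (stft g fx z)\<bar> \<le> 2 * (d * M)"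
      using norm_triangle_ineq3[of "stft g f z" "stft g (\<lambda>t. \<Sum>m\<in>G. c m * ?T m t) z"]
        norm_triangle_ineq3[of "stft g fx z" "stft g (\<lambda>t. \<Sum>m\<in>G. cnj (c m) * ?T m t) z"]
      by linarith
    also have "\<dots> \<le> d * (2 * (M + 1))"
      using \<open>0 < d\<close> by (simp add: algebra_simps)
    also have "\<dots> = e"
      using \<open>0 \<le> M\<close> by (simp add: d_def)
    finally show ?thesis by simp
  qed
  then have "\<bar>cmod (stft g f z) - cmod (stft g fx z)\<bar> \<le> 0"
    by (rule field_le_epsilon)
  then show "cmod (stft g f (S *v pair_vec x l)) = cmod (stft g fx (S *v pair_vec x l))"
    by (simp add: z_def)
qed

end
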